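(* Let $(T,\Omega,\mu,\beta)$ be an ergodic measure preserving dynamical system on a standard probability space. Let $\mathcal{C}\subset S^\infty(\Omega,G)$ be a class of cocycles equipped with a distance $d_{\mathcal{C}}$ such that $d_{\mathcal{C}}(g_1,g_2)\ge d_\infty(g_1,g_2)$ for all $g_1,g_2\in\mathcal{C}$, and let $\mathcal{C}_+=\{g\in\mathcal{C}:\ell(g)>0\}$. Suppose that every $g\in\mathcal{C}_+$ satisfies a uniform large deviation estimate of exponential type. Then: 1) The drift $\ell:\mathcal{C}\to\mathbb{R}$ is continuous. 2) The drift $\ell:\mathcal{C}_+\to\mathbb{R}$ is locally Hölder continuous. 3) The map $\xi:\mathcal{C}_+\to S^1(\Omega,\partial X)$, $g\mapsto\xi_g$, is locally Hölder continuous. Here $\mathcal C$ and $\mathcal C_+$ carry the distance $d_{\mathcal C}$ and $S^1(\Omega,\partial X)$ the distance $d_1$.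
   Context: Geometry. For a metric space $(X,d)$ put $\langle x,z\rangle_y=\frac12(d(x,y)+d(y,z)-d(x,z))$. $X$ is $\delta$-hyperbolic ($\delta>0$) if $\langle x,z\rangle_w\ge\min\{\langle x,y\rangle_w,\langle y,z\rangle_w\}-\delta$ for all $x,y,z,w\in X$. Fix a basepoint $x_0\in X$. A sequence $(x_n)$ in $X$ is a Gromov sequence if $\langle x_n,x_m\rangle_{x_0}\to\infty$ as $n,m\to\infty$; two Gromov sequences are equivalent if $\langle x_n,y_n\rangle_{x_0}\to\infty$. The Gromov boundary $\partial X$ is the set of equivalence classes, and $\mathrm{Bord}\,X=X\cup\partial X$. The Gromov product is extended to $\mathrm{Bord}\,X$ by $\langle\xi,\eta\rangle_z=\inf\liminf_{n,m\to\infty}\langle x_n,y_m\rangle_z$, the infimum being over sequences $(x_n)\in\xi$, $(y_m)\in\eta$ (constant sequences being used for points of $X$). Fix $1<b\le 2^{1/\delta}$ and set $\rho_{x,b}(\xi,\eta)=b^{-\langle\xi,\eta\rangle_x}$ on $\mathrm{Bord}\,X$. $X$ is strongly hyperbolic if for every $x\in X$ the map $\rho_{x,b}$ satisfies the triangle inequality on $\mathrm{Bord}\,X$. Throughout, $X$ is a geodesic, separable (not necessarily proper) strongly hyperbolic metric space. Put $\overline{D}_b=\rho_{x_0,b}$ and $D_b(\xi,\eta)=\min\{(\log b)d(\xi,\eta),\overline{D}_b(\xi,\eta)\}$ with the convention $d(\xi,\eta)=\infty$ if $\xi\ne\eta$ and at least one of them lies in $\partial X$; $D_b$ is a metric on $\mathrm{Bord}\,X$.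 $G$ is the group of isometries of $X$; it acts on $\partial X$ by $g[x_n]=[gx_n]$, and carries the metric $d_G(g_1,g_2)=\max\{\sup_{\xi\in\mathrm{Bord} X}D_b(g_1\xi,g_2\xi),\ \sup_{\xi\in\mathrm{Bord} X}D_b(g_1^{-1}\xi,g_2^{-1}\xi)\}$. Cocycles. For measurable $g:\Omega\to G$ put $g^{(n)}(\omega)=g(\omega)g(T\omega)\cdots g(T^{n-1}\omega)$. $S^\infty(\Omega,G)$ is the set of measurable $g:\Omega\to G$ with $\omega\mapsto g(\omega)^{-1}$ measurable and $d_\infty(g):=\sup_{\omega}b^{d(g(\omega)x_0,x_0)}<\infty$, modulo the relation $d_\infty(g_1,g_2)=0$, where $d_\infty(g_1,g_2)=\mathrm{ess\,sup}_{\omega\in\Omega}d_G(g_1(\omega),g_2(\omega))$; $d_\infty$ is a metric on it. The finite scale drift is $\ell_n(g)=\frac1n\int_\Omega d(g^{(n)}(\omega)x_0,x_0)\,d\mu(\omega)$ and the drift is $\ell(g)=\lim_{n\to\infty}\ell_n(g)$. Large deviations. $g\in\mathcal{C}$ satisfies a uniform large deviation estimate of exponential type if there are constants $r>0$, $c>0$ and for every $\varepsilon>0$ there exists $\overline{n}=\overline{n}(\varepsilon)$ such that $\mu\{\omega\in\Omega:|\frac1n d(g_1^{(n)}(\omega)x_0,x_0)-\ell_n(g_1)|>\varepsilon\}<b^{-c\varepsilon^2n}$ for every $g_1\in\mathcal{C}$ with $d_{\mathcal{C}}(g,g_1)<r$ and every $n\ge\overline{n}$. Hitting point. If $\ell(g)>0$,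 then for almost every $\omega$ the sequence $(g^{(n)}(\omega)x_0)_n$ is a Gromov sequence; $\xi_g(\omega)\in\partial X$ denotes its class (the limit of $g^{(n)}(\omega)x_0$). $S^1(\Omega,\partial X)$ is the space of measurable maps $\Omega\to\partial X$ with $d_1(f_1,f_2)=\int_\Omega\overline{D}_b(f_1(\omega),f_2(\omega))\,d\mu(\omega)$. A map is locally Hölder continuous if every point of its domain has a neighbourhood on which it is Hölder continuous (for some positive exponent and constant). *)

theory Defs
  imports "HOL-Probability.Probability"
begin

section \<open>Gromov hyperbolic geometry\<close>

text \<open>The base point of a Gromov product is the first argument.\<close>

definition gromov_prod :: "'x::metric_space \<Rightarrow> 'x \<Rightarrow> 'x \<Rightarrow> real" where
  "gromov_prod y x z = (dist x y + dist y z - dist x z) / 2"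

definition gromov_hyperbolic :: "'x::metric_space set \<Rightarrow> real \<Rightarrow> bool" where
  "gromov_hyperbolic X \<delta> \<longleftrightarrow> \<delta> > 0 \<and>
     (\<forall>x\<in>X. \<forall>y\<in>X. \<forall>z\<in>X. \<forall>w\<in>X.
        gromov_prod w x z \<ge> min (gromov_prod w x y) (gromov_prod w y z) - \<delta>)"

definition geodesic_space :: "'x::metric_space set \<Rightarrow> bool" where
  "geodesic_space X \<longleftrightarrow>
     (\<forall>x\<in>X. \<forall>y\<in>X. \<exists>\<gamma>::real \<Rightarrow> 'x. \<gamma> ` {0..dist x y} \<subseteq> X \<and> \<gamma> 0 = x \<and> \<gamma> (dist x y) = y \<and>
        (\<forall>s\<in>{0..dist x y}. \<forall>t\<in>{0..dist x y}. dist (\<gamma> s) (\<gamma> t) = \<bar>s - t\<bar>))"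

definition gromov_seq :: "'x::metric_space \<Rightarrow> (nat \<Rightarrow> 'x) \<Rightarrow> bool" where
  "gromov_seq x0 x \<longleftrightarrow>
     filterlim (\<lambda>(n, m). gromov_prod x0 (x n) (x m)) at_top (sequentially \<times>\<^sub>F sequentially)"

definition gromov_rel :: "'x::metric_space \<Rightarrow> ((nat \<Rightarrow> 'x) \<times> (nat \<Rightarrow> 'x)) set" where
  "gromov_rel x0 = {(x, y). gromov_seq x0 x \<and> gromov_seq x0 y \<and>
     filterlim (\<lambda>n. gromov_prod x0 (x n) (y n)) at_top sequentially}"

text \<open>Points of the bordification: a point of the space, or an equivalence class of Gromov
  sequences. The type contains junk of the second kind; the bordification itself is the set
  \<open>bord x0\<close> below.\<close>

datatype 'x bord_pt = Inner 'x | Bdry "(nat \<Rightarrow> 'x) set"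

definition boundary :: "'x::metric_space \<Rightarrow> 'x bord_pt set" where
  "boundary x0 = Bdry ` ({x. gromov_seq x0 x} // gromov_rel x0)"

definition bord :: "'x::metric_space \<Rightarrow> 'x bord_pt set" where
  "bord x0 = range Inner \<union> boundary x0"

fun rep_seqs :: "'x bord_pt \<Rightarrow> (nat \<Rightarrow> 'x) set" where
  "rep_seqs (Inner x) = {\<lambda>_. x}"
| "rep_seqs (Bdry c) = c"

text \<open>The extended product takes the value \<open>\<infinity>\<close>, e.g. for two equal boundary points.\<close>

definition gromov_prod_ext :: "'x::metric_space \<Rightarrow> 'x bord_pt \<Rightarrow> 'x bord_pt \<Rightarrow> ereal" where
  "gromov_prod_ext z \<xi> \<eta> =
     (INF (x, y) \<in> rep_seqs \<xi> \<times> rep_seqs \<eta>.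
        Liminf (sequentially \<times>\<^sub>F sequentially) (\<lambda>(n, m). ereal (gromov_prod z (x n) (y m))))"

definition rho :: "'x::metric_space \<Rightarrow> real \<Rightarrow> 'x bord_pt \<Rightarrow> 'x bord_pt \<Rightarrow> real" where
  "rho x b \<xi> \<eta> = (if gromov_prod_ext x \<xi> \<eta> = \<infinity> then 0
                  else b powr (- real_of_ereal (gromov_prod_ext x \<xi> \<eta>)))"

text \<open>The base point \<open>x0\<close> only enters through the definition of the boundary.\<close>

definition strongly_hyperbolic :: "'x::metric_space \<Rightarrow> real \<Rightarrow> bool" where
  "strongly_hyperbolic x0 b \<longleftrightarrow>
     (\<forall>x. \<forall>\<xi>\<in>bord x0. \<forall>\<eta>\<in>bord x0. \<forall>\<zeta>\<in>bord x0. rho x b \<xi> \<zeta> \<le> rho x b \<xi> \<eta> + rho x b \<eta> \<zeta>)"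

fun bord_edist :: "'x::metric_space bord_pt \<Rightarrow> 'x bord_pt \<Rightarrow> ereal" where
  "bord_edist (Inner x) (Inner y) = ereal (dist x y)"
| "bord_edist \<xi> \<eta> = (if \<xi> = \<eta> then 0 else \<infinity>)"

definition bord_metric :: "'x::metric_space \<Rightarrow> real \<Rightarrow> 'x bord_pt \<Rightarrow> 'x bord_pt \<Rightarrow> real" where
  "bord_metric x0 b \<xi> \<eta> =
     real_of_ereal (min (ereal (ln b) * bord_edist \<xi> \<eta>) (ereal (rho x0 b \<xi> \<eta>)))"

section \<open>The isometry group\<close>

definition isometries :: "('x::metric_space \<Rightarrow> 'x) set" where
  "isometries = {g. bij g \<and> (\<forall>x y. dist (g x) (g y) = dist x y)}"

text \<open>On the boundary, \<open>g[x] = [g \<circ> x]\<close>; the union is over equal classes.\<close>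

fun bord_act :: "'x::metric_space \<Rightarrow> ('x \<Rightarrow> 'x) \<Rightarrow> 'x bord_pt \<Rightarrow> 'x bord_pt" where
  "bord_act x0 g (Inner x) = Inner (g x)"
| "bord_act x0 g (Bdry c) = Bdry (\<Union>x\<in>c. gromov_rel x0 `` {g \<circ> x})"

text \<open>The suprema are over bounded sets, since \<open>bord_metric\<close> takes values in \<open>[0, 1]\<close>.\<close>

definition isom_dist :: "'x::metric_space \<Rightarrow> real \<Rightarrow> ('x \<Rightarrow> 'x) \<Rightarrow> ('x \<Rightarrow> 'x) \<Rightarrow> real" where
  "isom_dist x0 b g1 g2 =
     max (SUP \<xi>\<in>bord x0. bord_metric x0 b (bord_act x0 g1 \<xi>) (bord_act x0 g2 \<xi>))
         (SUP \<xi>\<in>bord x0. bord_metric x0 b (bord_act x0 (inv g1) \<xi>) (bord_act x0 (inv g2) \<xi>))"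

definition metric_borel :: "'a set \<Rightarrow> ('a \<Rightarrow> 'a \<Rightarrow> real) \<Rightarrow> 'a measure" where
  "metric_borel A d = sigma A {U. openin (Metric_space.mtopology A d) U}"

section \<open>Dynamics and cocycles\<close>

text \<open>Up to a null set, the underlying space is Polish and the measurable sets lie between the Borel
  sets and their completion. This covers both usual conventions: standard Borel spaces with a
  Borel probability, and (complete) Lebesgue--Rokhlin spaces.\<close>

definition standard_prob_space :: "'w measure \<Rightarrow> bool" where
  "standard_prob_space M \<longleftrightarrow> prob_space M \<and>
     (\<exists>\<tau>. completely_metrizable_space \<tau> \<and> second_countable \<tau> \<and>
        topspace \<tau> \<in> sets M \<and> emeasure M (space M - topspace \<tau>) = 0 \<and>
        (\<forall>U. openin \<tau> U \<longrightarrow> U \<in> sets M) \<and>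
        (\<forall>A\<in>sets M. A \<subseteq> topspace \<tau> \<longrightarrow>
           (\<exists>B \<in> sigma_sets (topspace \<tau>) {U. openin \<tau> U}.
            \<exists>B' \<in> sigma_sets (topspace \<tau>) {U. openin \<tau> U}.
              B \<subseteq> A \<and> A \<subseteq> B' \<and> emeasure M (B' - B) = 0)))"

definition ergodic_mpt :: "'w measure \<Rightarrow> ('w \<Rightarrow> 'w) \<Rightarrow> bool" where
  "ergodic_mpt M T \<longleftrightarrow> T \<in> M \<rightarrow>\<^sub>M M \<and> distr M M T = M \<and>
     (\<forall>A\<in>sets M. T -` A \<inter> space M = A \<longrightarrow> measure M A = 0 \<or> measure M A = 1)"

primrec cocycle :: "('w \<Rightarrow> 'w) \<Rightarrow> ('w \<Rightarrow> 'x \<Rightarrow> 'x) \<Rightarrow> nat \<Rightarrow> 'w \<Rightarrow> 'x \<Rightarrow> 'x" where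
  "cocycle T g 0 \<omega> = id"
| "cocycle T g (Suc n) \<omega> = cocycle T g n \<omega> \<circ> g ((T ^^ n) \<omega>)"

definition bounded_cocycles ::
  "'w measure \<Rightarrow> 'x::metric_space \<Rightarrow> real \<Rightarrow> ('w \<Rightarrow> 'x \<Rightarrow> 'x) set" where
  "bounded_cocycles M x0 b =
     {g. g \<in> M \<rightarrow>\<^sub>M metric_borel isometries (isom_dist x0 b) \<and>
         (\<lambda>\<omega>. inv (g \<omega>)) \<in> M \<rightarrow>\<^sub>M metric_borel isometries (isom_dist x0 b) \<and>
         bdd_above ((\<lambda>\<omega>. b powr dist (g \<omega> x0) x0) ` space M)}"

definition dist_infty ::
  "'w measure \<Rightarrow> 'x::metric_space \<Rightarrow> real \<Rightarrow> ('w \<Rightarrow> 'x \<Rightarrow> 'x) \<Rightarrow> ('w \<Rightarrow> 'x \<Rightarrow> 'x) \<Rightarrow> ereal" where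
  "dist_infty M x0 b g1 g2 = esssup M (\<lambda>\<omega>. ereal (isom_dist x0 b (g1 \<omega>) (g2 \<omega>)))"

definition S_infty ::
  "'w measure \<Rightarrow> 'x::metric_space \<Rightarrow> real \<Rightarrow> ('w \<Rightarrow> 'x \<Rightarrow> 'x) set set" where
  "S_infty M x0 b = bounded_cocycles M x0 b //
     {(g1, g2). g1 \<in> bounded_cocycles M x0 b \<and> g2 \<in> bounded_cocycles M x0 b \<and>
        dist_infty M x0 b g1 g2 = 0}"

text \<open>Elements of \<open>S_infty\<close> are classes; the quantities below are defined for representatives and
  are applied to a class via a chosen one (almost everywhere equal representatives give the
  same values).\<close>

definition rep :: "'a set \<Rightarrow> 'a" where
  "rep c = (SOME g. g \<in> c)"

definition finite_drift ::
  "'w measure \<Rightarrow> ('w \<Rightarrow> 'w) \<Rightarrow> 'x::metric_space \<Rightarrow> nat \<Rightarrow> ('w \<Rightarrow> 'x \<Rightarrow> 'x) \<Rightarrow> real" where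
  "finite_drift M T x0 n g = (1 / real n) * (\<integral>\<omega>. dist (cocycle T g n \<omega> x0) x0 \<partial>M)"

definition drift ::
  "'w measure \<Rightarrow> ('w \<Rightarrow> 'w) \<Rightarrow> 'x::metric_space \<Rightarrow> ('w \<Rightarrow> 'x \<Rightarrow> 'x) \<Rightarrow> real" where
  "drift M T x0 g = lim (\<lambda>n. finite_drift M T x0 n g)"

definition positive_drift ::
  "'w measure \<Rightarrow> ('w \<Rightarrow> 'w) \<Rightarrow> 'x::metric_space \<Rightarrow> ('w \<Rightarrow> 'x \<Rightarrow> 'x) set set \<Rightarrow>
   ('w \<Rightarrow> 'x \<Rightarrow> 'x) set set" where
  "positive_drift M T x0 C = {g\<in>C. drift M T x0 (rep g) > 0}"

definition uniform_LDE ::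
  "'w measure \<Rightarrow> ('w \<Rightarrow> 'w) \<Rightarrow> 'x::metric_space \<Rightarrow> real \<Rightarrow> ('w \<Rightarrow> 'x \<Rightarrow> 'x) set set \<Rightarrow>
   (('w \<Rightarrow> 'x \<Rightarrow> 'x) set \<Rightarrow> ('w \<Rightarrow> 'x \<Rightarrow> 'x) set \<Rightarrow> real) \<Rightarrow> ('w \<Rightarrow> 'x \<Rightarrow> 'x) set \<Rightarrow> bool" where
  "uniform_LDE M T x0 b C dC g \<longleftrightarrow>
     (\<exists>r>0. \<exists>c>0. \<forall>\<epsilon>>0. \<exists>N::nat. \<forall>g1\<in>C. dC g g1 < r \<longrightarrow> (\<forall>n\<ge>N.
        measure M {\<omega>\<in>space M. \<bar>(1 / real n) * dist (cocycle T (rep g1) n \<omega> x0) x0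
                                - finite_drift M T x0 n (rep g1)\<bar> > \<epsilon>}
          < b powr (- c * \<epsilon>\<^sup>2 * real n)))"

text \<open>For a cocycle of positive drift the first case holds almost everywhere; the fixed boundary
  point used on the exceptional null set is irrelevant.\<close>

definition hitting_point ::
  "('w \<Rightarrow> 'w) \<Rightarrow> 'x::metric_space \<Rightarrow> ('w \<Rightarrow> 'x \<Rightarrow> 'x) \<Rightarrow> 'w \<Rightarrow> 'x bord_pt" where
  "hitting_point T x0 g \<omega> =
     (if gromov_seq x0 (\<lambda>n. cocycle T g n \<omega> x0)
      then Bdry (gromov_rel x0 `` {\<lambda>n. cocycle T g n \<omega> x0})
      else (SOME \<xi>. \<xi> \<in> boundary x0))"

definition S_one :: "'w measure \<Rightarrow> 'x::metric_space \<Rightarrow> real \<Rightarrow> ('w \<Rightarrow> 'x bord_pt) set" where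
  "S_one M x0 b = M \<rightarrow>\<^sub>M metric_borel (boundary x0) (rho x0 b)"

definition dist_one ::
  "'w measure \<Rightarrow> 'x::metric_space \<Rightarrow> real \<Rightarrow> ('w \<Rightarrow> 'x bord_pt) \<Rightarrow> ('w \<Rightarrow> 'x bord_pt) \<Rightarrow> real" where
  "dist_one M x0 b f1 f2 = (\<integral>\<omega>. rho x0 b (f1 \<omega>) (f2 \<omega>) \<partial>M)"

definition locally_hoelder ::
  "'a set \<Rightarrow> ('a \<Rightarrow> 'a \<Rightarrow> real) \<Rightarrow> ('c \<Rightarrow> 'c \<Rightarrow> real) \<Rightarrow> ('a \<Rightarrow> 'c) \<Rightarrow> bool" where
  "locally_hoelder A dA dB f \<longleftrightarrow>
     (\<forall>a\<in>A. \<exists>U. openin (Metric_space.mtopology A dA) U \<and> a \<in> U \<and>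
        (\<exists>\<alpha>>0. \<exists>K>0. \<forall>x\<in>U. \<forall>y\<in>U. dB (f x) (f y) \<le> K * dA x y powr \<alpha>))"

end

theory Submission
  imports Defs
begin

text \<open>
  Let \<open>f_n(\<omega>) = d(g\<^sup>n(\<omega>) x0, x0)\<close>, let \<open>F_n\<close> be its mean and \<open>p_n\<close> the mean of \<open>b powr (- f_n)\<close>.
  The increment \<open>f_(n+1)(\<omega>) - f_n(T \<omega>)\<close> is expressed by a Gromov product with the point
  \<open>g(\<omega>)\<^sup>-\<^sup>1 x0\<close>, which stays in a bounded set, so strong hyperbolicity makes \<open>a_n = F_(n+1) - F_n\<close> vary by at most a
  multiple of \<open>p_n\<close>. As long as \<open>F_n \<ge> n l / 2\<close>, where \<open>l\<close> is the drift at a given cocycle, the large deviation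
  estimate makes \<open>p_n\<close> exponentially small; hence \<open>a_n\<close> is nearly constant, which in turn propagates
  \<open>F_n \<ge> n l / 2\<close> to all \<open>n\<close>, uniformly over nearby cocycles. So \<open>a_n\<close>, and likewise \<open>g\<^sup>n x0\<close>
  in the visual distance, converges at a uniform exponential rate to the drift and to the
  hitting point. At time \<open>n\<close> both depend on the cocycle in a Lipschitz way with constant \<open>B\<^sup>n\<close>, and balancing
  the two errors gives the Hoelder bounds. At zero drift, continuity is upper semicontinuity,
  which holds because the drift is an infimum of continuous functions.
\<close>

section \<open>Gromov products and visual distances\<close>

text \<open>The averages F_n / n in general approach the drift only at speed 1 / n, because an
  initial error is merely divided by n. The increments a_n keep no memory of it, and this opens the
  way to an exponential rate. The obstacle is a circle. The large deviation estimate concentrates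
  f_n / n around F_n / n, so it makes p_n small only where F_n is already known to be large, while
  the drift of a nearby cocycle is still unknown. The circle is broken at one finite time n: up to n
  + 1 the growth of F_k is inherited from g by Lipschitz dependence, and beyond n the total
  variation of the increments is a geometric tail smaller than the reserve left by g. The estimate
  is used at the single deviation l / 4, half of the rate l / 2 granted to the neighbours. The base
  B comes from the metric on the group, a supremum of minima of ln b times a distance and a visual
  distance. At distance r from x0 the visual term is only known to be at least b^(-r), so turning it
  into a bound on distances at radius n R costs b^(2 n R). With a linear factor n absorbed by 2^n
  this gives B = 2 b^(2 R).\<close>

lemma gromov_prod_commute: "gromov_prod w x y = gromov_prod w y x"
  by (simp add: gromov_prod_def dist_commute)

lemma gromov_prod_nonneg: "0 \<le> gromov_prod w x y"
  using dist_triangle2[of x y w] by (simp add: gromov_prod_def dist_commute)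

lemma gromov_prod_le_dist: "gromov_prod w x y \<le> dist x w"
  using dist_triangle[of y w x] by (simp add: gromov_prod_def dist_commute)

lemma gromov_prod_ge: "dist x w - dist x y \<le> gromov_prod w x y"
  using dist_triangle[of x w y] by (simp add: gromov_prod_def dist_commute)

lemma gromov_prod_lipschitz: "gromov_prod w x z \<le> gromov_prod w y z + dist x y"
  using dist_triangle[of x w y] dist_triangle[of y z x] dist_commute[of y x]
  unfolding gromov_prod_def by (simp add: field_simps)

lemma gromov_prod_ext_Inner:
  "gromov_prod_ext w (Inner x) (Inner y) = ereal (gromov_prod w x y)"
  by (simp add: gromov_prod_ext_def case_prod_unfold Liminf_const prod_filter_eq_bot)

lemma gromov_prod_ext_nonneg: "0 \<le> gromov_prod_ext w \<xi> \<eta>"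
  unfolding gromov_prod_ext_def
  by (auto intro!: INF_greatest Liminf_bounded always_eventually simp: gromov_prod_nonneg)

lemma gromov_prod_ext_commute: "gromov_prod_ext w \<xi> \<eta> = gromov_prod_ext w \<eta> \<xi>"
proof -
  have le: "gromov_prod_ext w \<xi> \<eta> \<le> gromov_prod_ext w \<eta> \<xi>" for \<xi> \<eta>
    unfolding gromov_prod_ext_def
  proof (rule INF_greatest)
    fix p assume "p \<in> rep_seqs \<eta> \<times> rep_seqs \<xi>"
    then obtain x y where p: "p = (x, y)" "x \<in> rep_seqs \<eta>" "y \<in> rep_seqs \<xi>" by auto
    let ?F = "sequentially \<times>\<^sub>F sequentially :: (nat \<times> nat) filter"
    have "Liminf ?F (\<lambda>(n, m). ereal (gromov_prod w (y n) (x m)))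
        = Liminf (filtermap prod.swap ?F) (\<lambda>(n, m). ereal (gromov_prod w (y n) (x m)))"
      using prod_filter_commute[of sequentially sequentially] by simp
    also have "\<dots> = Liminf ?F (\<lambda>(n, m). ereal (gromov_prod w (x n) (y m)))"
      by (subst Liminf_filtermap_eq) (auto simp: case_prod_unfold gromov_prod_commute[of w "y _"])
    finally show "(INF (x, y) \<in> rep_seqs \<xi> \<times> rep_seqs \<eta>.
        Liminf ?F (\<lambda>(n, m). ereal (gromov_prod w (x n) (y m))))
      \<le> (case p of (x, y) \<Rightarrow> Liminf ?F (\<lambda>(n, m). ereal (gromov_prod w (x n) (y m))))"
      using p by (intro INF_lower2[of "(y, x)"]) auto
  qed
  show ?thesis by (rule antisym) (rule le)+
qed

text \<open>Replacing the constant sequence \<open>x\<close> by \<open>y\<close> changes every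
  product by at most \<open>dist x y\<close>, uniformly in the second sequence, so the bound passes
  through \<open>Liminf\<close> and \<open>INF\<close>. The additive form keeps its meaning for junk
  points with an empty class, where both products are infinite.\<close>

lemma gromov_prod_ext_lipschitz:
  "gromov_prod_ext w (Inner y) \<eta> \<le> gromov_prod_ext w (Inner x) \<eta> + ereal (dist x y)"
proof -
  let ?F = "sequentially \<times>\<^sub>F sequentially :: (nat \<times> nat) filter"
  have "gromov_prod_ext w (Inner y) \<eta> - ereal (dist x y) \<le> gromov_prod_ext w (Inner x) \<eta>"
    unfolding gromov_prod_ext_def[of w "Inner x"]
  proof (rule INF_greatest)
    fix p assume "p \<in> rep_seqs (Inner x) \<times> rep_seqs \<eta>"
    then obtain z where p: "p = (\<lambda>_. x, z)" "z \<in> rep_seqs \<eta>" by auto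
    have 1: "gromov_prod_ext w (Inner y) \<eta> \<le> Liminf ?F (\<lambda>(n, m). ereal (gromov_prod w y (z m)))"
      unfolding gromov_prod_ext_def using p by (intro INF_lower2[of "(\<lambda>_. y, z)"]) auto
    have "gromov_prod_ext w (Inner y) \<eta> - ereal (dist x y)
        \<le> Liminf ?F (\<lambda>(n, m). ereal (gromov_prod w x (z m)))"
      unfolding le_Liminf_iff
    proof (intro allI impI)
      fix u assume "u < gromov_prod_ext w (Inner y) \<eta> - ereal (dist x y)"
      then have "u + ereal (dist x y) < gromov_prod_ext w (Inner y) \<eta>"
        by (cases u; cases "gromov_prod_ext w (Inner y) \<eta>") auto
      also note 1
      finally have "u + ereal (dist x y) < Liminf ?F (\<lambda>(n, m). ereal (gromov_prod w y (z m)))" .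
      then have "\<forall>\<^sub>F p in ?F. u + ereal (dist x y) < (case p of (n, m) \<Rightarrow> ereal (gromov_prod w y (z m)))"
        using le_Liminf_iff by blast
      then show "\<forall>\<^sub>F p in ?F. u < (case p of (n, m) \<Rightarrow> ereal (gromov_prod w x (z m)))"
      proof eventually_elim
        case (elim p)
        then show ?case using gromov_prod_lipschitz[of w y "z (snd p)" x]
          by (cases u) (auto simp: case_prod_beta dist_commute)
      qed
    qed
    then show "gromov_prod_ext w (Inner y) \<eta> - ereal (dist x y)
      \<le> (case p of (x, y) \<Rightarrow> Liminf ?F (\<lambda>(n, m). ereal (gromov_prod w (x n) (y m))))"
      using p by simp
  qed
  then show ?thesis by (simp add: ereal_minus_le)
qed

section \<open>Visual distances and the metric on the bordification\<close>

lemma rho_commute: "rho w b \<xi> \<eta> = rho w b \<eta> \<xi>"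
  by (simp add: rho_def gromov_prod_ext_commute)

lemma rho_nonneg: "0 \<le> rho w b \<xi> \<eta>"
  by (simp add: rho_def)

lemma rho_Inner: "rho w b (Inner x) (Inner y) = b powr (- gromov_prod w x y)"
  by (simp add: rho_def gromov_prod_ext_Inner)

lemma rho_le_1:
  assumes "1 < b" shows "rho w b \<xi> \<eta> \<le> 1"
  using assms gromov_prod_ext_nonneg[of w \<xi> \<eta>]
  by (cases "gromov_prod_ext w \<xi> \<eta>") (use powr_mono[of "- real_of_ereal (gromov_prod_ext w \<xi> \<eta>)" 0 b] in \<open>auto simp: rho_def\<close>)

lemma rho_eq_0_iff:
  assumes "1 < b" shows "rho w b \<xi> \<eta> = 0 \<longleftrightarrow> gromov_prod_ext w \<xi> \<eta> = \<infinity>"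
  using assms by (simp add: rho_def)

text \<open>On the half-line of nonnegative reals the slope of b^(-s) is at most \<open>ln b\<close>
  in absolute value. Only \<open>s\<close> needs a sign: for t < s the left side is not
  positive.\<close>

lemma powr_neg_diff_le:
  fixes b s t :: real
  assumes "1 < b" "0 \<le> s"
  shows "b powr - s - b powr - t \<le> ln b * \<bar>t - s\<bar>"
proof (cases "s \<le> t")
  case True
  have "1 + ln b * (s - t) \<le> exp (ln b * (s - t))" by (rule exp_ge_add_one_self)
  then have e: "1 - b powr (s - t) \<le> ln b * (t - s)"
    using assms by (simp add: powr_def algebra_simps)
  have "b powr - s - b powr - t = b powr - s * (1 - b powr (s - t))"
    using assms by (simp add: right_diff_distrib flip: powr_add)
  also have "\<dots> \<le> 1 * (ln b * (t - s))"
  proof (rule mult_mono[OF _ e])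
    show "b powr - s \<le> 1" using assms powr_mono[of "-s" 0 b] by simp
    show "0 \<le> 1 - b powr (s - t)" using assms True powr_mono[of "s - t" 0 b] by simp
  qed auto
  finally show ?thesis using True by simp
next
  case False
  then have "b powr - s \<le> b powr - t" using assms by (intro powr_mono) auto
  moreover have "0 \<le> ln b * \<bar>t - s\<bar>" using assms by simp
  ultimately show ?thesis by linarith
qed

text \<open>Below \<open>R\<close> the slope of b^(-s) is at least \<open>ln b * b powr - R\<close>
  in absolute value. This converts visual distances back into Gromov products, at a price
  exponential in the bound on the products.\<close>

lemma diff_le_powr_neg_diff:
  fixes b s t R :: real
  assumes "1 < b" "s \<le> R" "t \<le> R"
  shows "\<bar>s - t\<bar> \<le> b powr R / ln b * \<bar>b powr - s - b powr - t\<bar>"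
proof -
  have *: "t - s \<le> b powr R / ln b * \<bar>b powr - s - b powr - t\<bar>" if "s \<le> t" "t \<le> R" for s t
  proof -
    have "ln b * (t - s) \<le> b powr (t - s) - 1"
      using exp_ge_add_one_self[of "ln b * (t - s)"] assms by (simp add: powr_def algebra_simps)
    also have "\<dots> = b powr t * (b powr - s - b powr - t)"
      using assms by (simp add: right_diff_distrib flip: powr_add)
    also have "\<dots> \<le> b powr R * \<bar>b powr - s - b powr - t\<bar>"
      using assms that by (intro mult_mono powr_mono) auto
    finally show ?thesis using assms by (simp add: field_simps)
  qed
  show ?thesis using *[of s t] *[of t s] assms by (cases "s \<le> t") (auto simp: abs_minus_commute)
qed

lemma rho_lipschitz_aux:
  assumes "1 < b" "gromov_prod_ext w (Inner x) \<eta> \<noteq> \<infinity>"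
  obtains s t where "0 \<le> s" "0 \<le> t" "t \<le> s + dist x y"
    "rho w b (Inner x) \<eta> = b powr - s" "rho w b (Inner y) \<eta> = b powr - t"
  using gromov_prod_ext_lipschitz[of w y \<eta> x] gromov_prod_ext_nonneg[of w "Inner x" \<eta>]
    gromov_prod_ext_nonneg[of w "Inner y" \<eta>] assms that
  by (cases "gromov_prod_ext w (Inner x) \<eta>"; cases "gromov_prod_ext w (Inner y) \<eta>")
    (auto simp: rho_def)

lemma rho_lipschitz:
  assumes "1 < b"
  shows "rho w b (Inner x) \<eta> \<le> rho w b (Inner y) \<eta> + ln b * dist x y"
\<comment> \<open>An infinite product with an inner point occurs only if \<open>\<eta>\<close> has
  no representing sequence, since otherwise it is at most \<open>dist x w\<close>.\<close>
proof (cases "gromov_prod_ext w (Inner x) \<eta> = \<infinity>")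
  case True
  then show ?thesis using assms rho_nonneg[of w b "Inner y" \<eta>] by (simp add: rho_def)
next
  case False
  from rho_lipschitz_aux[OF assms this, of y] obtain s t where st: "0 \<le> s" "0 \<le> t" "t \<le> s + dist x y"
    "rho w b (Inner x) \<eta> = b powr - s" "rho w b (Inner y) \<eta> = b powr - t" .
  show ?thesis
  proof (cases "s \<le> t")
    case True
    then have "ln b * \<bar>t - s\<bar> \<le> ln b * dist x y" using st assms by (intro mult_left_mono) auto
    then show ?thesis using powr_neg_diff_le[OF assms st(1), of t] st by simp
  next
    case False
    then have "b powr - s \<le> b powr - t" using assms by (intro powr_mono) auto
    moreover have "0 \<le> ln b * dist x y" using assms by simp
    ultimately show ?thesis using st by simp
  qed
qed

lemma bord_metric_eq:
  assumes "1 < b"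
  shows "bord_metric x0 b (Inner x) (Inner y) = min (ln b * dist x y) (rho x0 b (Inner x) (Inner y))"
    and "bord_metric x0 b \<xi> \<xi> = 0"
    and "bord_edist \<xi> \<eta> = \<infinity> \<Longrightarrow> bord_metric x0 b \<xi> \<eta> = rho x0 b \<xi> \<eta>"
proof -
  show "bord_metric x0 b (Inner x) (Inner y) = min (ln b * dist x y) (rho x0 b (Inner x) (Inner y))"
    by (simp add: bord_metric_def min_def)
  have "bord_edist \<xi> \<xi> = 0" by (cases \<xi>) (auto simp: zero_ereal_def)
  then show "bord_metric x0 b \<xi> \<xi> = 0"
    using rho_nonneg[of x0 b \<xi> \<xi>] by (simp add: bord_metric_def min_def zero_ereal_def)
  show "bord_edist \<xi> \<eta> = \<infinity> \<Longrightarrow> bord_metric x0 b \<xi> \<eta> = rho x0 b \<xi> \<eta>"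
    using assms by (simp add: bord_metric_def min_def)
qed

lemma bord_edist_cases:
  obtains x y where "\<xi> = Inner x" "\<eta> = Inner y" | "\<xi> = \<eta>" | "bord_edist \<xi> \<eta> = \<infinity>"
  by (cases \<xi>; cases \<eta>) (auto, metis)

lemma bord_edist_commute: "bord_edist \<xi> \<eta> = bord_edist \<eta> \<xi>"
  by (cases \<xi>; cases \<eta>) (auto simp: dist_commute)

lemma bord_metric_commute: "bord_metric x0 b \<xi> \<eta> = bord_metric x0 b \<eta> \<xi>"
  by (simp add: bord_metric_def bord_edist_commute[of \<xi>] rho_commute[of _ _ \<xi>])

lemma bord_metric_nonneg: "1 < b \<Longrightarrow> 0 \<le> bord_metric x0 b \<xi> \<eta>"
  by (rule bord_edist_cases[of \<xi> \<eta>]) (auto simp: bord_metric_eq rho_nonneg)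

lemma bord_metric_le_rho: "1 < b \<Longrightarrow> bord_metric x0 b \<xi> \<eta> \<le> rho x0 b \<xi> \<eta>"
  by (rule bord_edist_cases[of \<xi> \<eta>]) (auto simp: bord_metric_eq rho_nonneg)

lemma bord_metric_le_1: "1 < b \<Longrightarrow> bord_metric x0 b \<xi> \<eta> \<le> 1"
  using bord_metric_le_rho rho_le_1 by (rule order_trans)

text \<open>Divergence of Gromov products becomes smallness of visual distances, so that Gromov
  sequences can be handled like Cauchy sequences, with the triangle inequality in place of the
  minimum inequality with defect.\<close>

lemma filterlim_at_top_iff_powr_neg:
  fixes f :: "'a \<Rightarrow> real"
  assumes "1 < b"
  shows "filterlim f at_top F \<longleftrightarrow> (\<forall>e>0. \<forall>\<^sub>F n in F. b powr - f n < e)"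
  unfolding filterlim_at_top_dense
proof safe
  fix e :: real assume *: "\<forall>Z. \<forall>\<^sub>F n in F. Z < f n" "0 < e"
  from *(1)[rule_format, of "- log b e"] show "\<forall>\<^sub>F n in F. b powr - f n < e"
  proof eventually_elim
    case (elim n)
    then have "b powr - f n < b powr (log b e)" using assms by (intro powr_less_mono) auto
    then show ?case using assms *(2) by simp
  qed
next
  fix Z assume *: "\<forall>e>0. \<forall>\<^sub>F n in F. b powr - f n < e"
  have "\<forall>\<^sub>F n in F. b powr - f n < b powr - Z" using *[rule_format, of "b powr - Z"] assms by simp
  then show "\<forall>\<^sub>F n in F. Z < f n"
  proof eventually_elim
    case (elim n)
    then show ?case using assms by simp
  qed
qed

lemma gromov_prod_base_lipschitz: "gromov_prod w x y \<le> gromov_prod v x y + dist w v"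
  using dist_triangle[of x w v] dist_triangle[of w y v] dist_commute[of w v]
  unfolding gromov_prod_def by (simp add: field_simps dist_commute)

section \<open>Elementary facts on isometries\<close>

lemma isometriesD:
  assumes "g \<in> isometries"
  shows "bij g" "dist (g x) (g y) = dist x y" "g (inv g x) = x" "inv g (g x) = x"
  using assms by (auto simp: isometries_def bij_is_inj bij_is_surj surj_f_inv_f)

lemma inv_isometries:
  assumes "g \<in> isometries" shows "inv g \<in> isometries"
proof -
  have "dist (inv g x) (inv g y) = dist x y" for x y
    using isometriesD(2)[OF assms, of "inv g x" "inv g y"] isometriesD(3)[OF assms] by simp
  then show ?thesis using isometriesD(1)[OF assms] by (simp add: isometries_def bij_imp_bij_inv)
qed

lemma isometries_comp: "g \<in> isometries \<Longrightarrow> h \<in> isometries \<Longrightarrow> g \<circ> h \<in> isometries"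
  by (auto simp: isometries_def bij_comp)

lemma id_isometries: "id \<in> isometries"
  by (auto simp: isometries_def)

lemma isometries_gromov_prod: "g \<in> isometries \<Longrightarrow> gromov_prod (g w) (g x) (g y) = gromov_prod w x y"
  by (simp add: gromov_prod_def isometriesD(2))

locale strongly_hyperbolic_space =
  fixes x0 :: "'x::metric_space" and b :: real
  assumes b: "1 < b" and sh: "strongly_hyperbolic x0 b"
begin

text \<open>This is \<open>rho x0 b\<close> on points of the space. It is symmetric and satisfies
  the triangle inequality, but it is not a metric: the self-distance
  \<open>vis x x = b powr - dist x x0\<close> is positive.\<close>

abbreviation vis :: "'x \<Rightarrow> 'x \<Rightarrow> real" where
  "vis x y \<equiv> b powr (- gromov_prod x0 x y)"

lemma Inner_bord [simp]: "Inner x \<in> bord x0"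
  by (simp add: bord_def)

lemma rho_triangle:
  "\<xi> \<in> bord x0 \<Longrightarrow> \<eta> \<in> bord x0 \<Longrightarrow> \<zeta> \<in> bord x0 \<Longrightarrow> rho x0 b \<xi> \<zeta> \<le> rho x0 b \<xi> \<eta> + rho x0 b \<eta> \<zeta>"
  using sh by (auto simp: strongly_hyperbolic_def)

lemma vis_triangle: "vis x z \<le> vis x y + vis y z"
  using rho_triangle[of "Inner x" "Inner y" "Inner z"] by (simp add: rho_Inner)

lemma vis_commute: "vis x y = vis y x"
  by (simp add: gromov_prod_commute)

section \<open>Gromov sequences and the boundary as a metric space\<close>

lemma gromov_seq_iff:
  "gromov_seq x0 x \<longleftrightarrow> (\<forall>e>0. \<exists>N. \<forall>m\<ge>N. \<forall>n\<ge>N. vis (x m) (x n) < e)"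
proof -
  have "(\<lambda>(n, m). gromov_prod x0 (x n) (x m)) = (\<lambda>(n, m). gromov_prod x0 (x m) (x n))"
    by (auto simp: fun_eq_iff gromov_prod_commute)
  then show ?thesis
    unfolding gromov_seq_def filterlim_at_top_iff_powr_neg[OF b]
    by (simp add: case_prod_unfold eventually_prod_sequentially)
qed

lemma gromov_rel_iff:
  "(x, y) \<in> gromov_rel x0 \<longleftrightarrow> gromov_seq x0 x \<and> gromov_seq x0 y \<and>
     (\<forall>e>0. \<forall>\<^sub>F n in sequentially. vis (x n) (y n) < e)"
  unfolding gromov_rel_def filterlim_at_top_iff_powr_neg[OF b] by simp

lemma equiv_gromov_rel: "equiv {x. gromov_seq x0 x} (gromov_rel x0)"
proof (rule equivI)
  show "gromov_rel x0 \<subseteq> {x. gromov_seq x0 x} \<times> {x. gromov_seq x0 x}"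
    by (auto simp: gromov_rel_def)
  show "refl_on {x. gromov_seq x0 x} (gromov_rel x0)"
    unfolding refl_on_def gromov_rel_iff gromov_seq_iff eventually_sequentially by blast
  show "sym (gromov_rel x0)"
    by (auto simp: sym_def gromov_rel_def gromov_prod_commute)
  show "trans (gromov_rel x0)"
  proof (rule transI)
    fix x y z assume *: "(x, y) \<in> gromov_rel x0" "(y, z) \<in> gromov_rel x0"
    have "\<forall>\<^sub>F n in sequentially. vis (x n) (z n) < e" if "e > 0" for e
    proof -
      have "\<forall>\<^sub>F n in sequentially. vis (x n) (y n) < e / 2" "\<forall>\<^sub>F n in sequentially. vis (y n) (z n) < e / 2"
        using * half_gt_zero[OF that] unfolding gromov_rel_iff by blast+
      then show ?thesis
      proof eventually_elim
        case (elim n)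
        then show ?case using vis_triangle[of "x n" "z n" "y n"] by simp
      qed
    qed
    then show "(x, z) \<in> gromov_rel x0" using * by (auto simp: gromov_rel_iff)
  qed
qed

abbreviation limit_pt :: "(nat \<Rightarrow> 'x) \<Rightarrow> 'x bord_pt" where
  "limit_pt x \<equiv> Bdry (gromov_rel x0 `` {x})"

lemma boundary_iff: "\<xi> \<in> boundary x0 \<longleftrightarrow> (\<exists>x. gromov_seq x0 x \<and> \<xi> = limit_pt x)"
  by (auto simp: boundary_def quotient_def)

lemma boundary_bord: "\<xi> \<in> boundary x0 \<Longrightarrow> \<xi> \<in> bord x0"
  by (simp add: bord_def)

lemma limit_pt_eq_iff:
  "gromov_seq x0 x \<Longrightarrow> gromov_seq x0 y \<Longrightarrow> limit_pt x = limit_pt y \<longleftrightarrow> (x, y) \<in> gromov_rel x0"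
  using eq_equiv_class_iff[OF equiv_gromov_rel, of x y] by simp

lemma rho_le_if_Liminf_ge:
  assumes "0 < c" "ereal (- log b c) \<le> gromov_prod_ext x0 \<xi> \<eta>"
  shows "rho x0 b \<xi> \<eta> \<le> c"
proof (cases "gromov_prod_ext x0 \<xi> \<eta>")
  case (real s)
  then have "b powr - s \<le> b powr log b c" using assms b by (intro powr_mono) auto
  then show ?thesis using real assms b by (simp add: rho_def)
qed (use assms in \<open>auto simp: rho_def\<close>)

text \<open>The extended product is an infimum over all representatives of the class. Any other
  representative \<open>z\<close> satisfies \<open>vis (x m) (z m)\<close> \<rightarrow> 0, so the
  triangle inequality transfers the bound from \<open>x\<close> to \<open>z\<close> with arbitrarily
  small loss, and testing one representative suffices.\<close>

lemma rho_Inner_limit_pt_le: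
  assumes "gromov_seq x0 x" and c: "\<forall>\<^sub>F m in sequentially. vis y (x m) \<le> c" "0 \<le> c"
  shows "rho x0 b (Inner y) (limit_pt x) \<le> c"
proof (rule field_le_epsilon)
  fix e :: real assume e: "0 < e"
  show "rho x0 b (Inner y) (limit_pt x) \<le> c + e"
  proof (rule rho_le_if_Liminf_ge)
    show "ereal (- log b (c + e)) \<le> gromov_prod_ext x0 (Inner y) (limit_pt x)"
      unfolding gromov_prod_ext_def
    proof (rule INF_greatest)
      fix p assume "p \<in> rep_seqs (Inner y) \<times> rep_seqs (limit_pt x)"
      then obtain z where p: "p = (\<lambda>_. y, z)" and z: "(x, z) \<in> gromov_rel x0" by auto
      have "\<forall>\<^sub>F m in sequentially. vis (x m) (z m) < e" using z e by (simp add: gromov_rel_iff)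
      with c(1) have "\<forall>\<^sub>F m in sequentially. - log b (c + e) \<le> gromov_prod x0 y (z m)"
      proof eventually_elim
        case (elim m)
        then have "vis y (z m) \<le> c + e" using vis_triangle[of y "z m" "x m"] by simp
        then show ?case using b c(2) e
          by (subst (asm) le_log_iff[symmetric]) auto
      qed
      then obtain N where "\<And>m. m \<ge> N \<Longrightarrow> - log b (c + e) \<le> gromov_prod x0 y (z m)"
        unfolding eventually_sequentially by meson
      then have "\<forall>\<^sub>F q in sequentially \<times>\<^sub>F sequentially.
          ereal (- log b (c + e)) \<le> (case q of (n :: nat, m) \<Rightarrow> ereal (gromov_prod x0 y (z m)))"
        by (auto simp: eventually_prod_sequentially)
      then show "ereal (- log b (c + e)) \<le> (case p of (x, y) \<Rightarrow>
          Liminf (sequentially \<times>\<^sub>F sequentially) (\<lambda>(n, m). ereal (gromov_prod x0 (x n) (y m))))"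
        using p by (auto intro: Liminf_bounded)
    qed
  qed (use c e in auto)
qed

lemma rho_limit_pt_tendsto:
  assumes "gromov_seq x0 x" "0 < e"
  shows "\<forall>\<^sub>F n in sequentially. rho x0 b (Inner (x n)) (limit_pt x) < e"
proof -
  have "\<exists>N. \<forall>m\<ge>N. \<forall>n\<ge>N. vis (x m) (x n) < e / 2"
    using assms(1) half_gt_zero[OF assms(2)] unfolding gromov_seq_iff by blast
  then obtain N where N: "\<And>m n. m \<ge> N \<Longrightarrow> n \<ge> N \<Longrightarrow> vis (x m) (x n) < e / 2" by meson
  have "rho x0 b (Inner (x n)) (limit_pt x) \<le> e / 2" if "n \<ge> N" for n
    using assms that N[OF that]
    by (intro rho_Inner_limit_pt_le) (auto simp: eventually_sequentially intro!: exI[of _ N] less_imp_le)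
  then show ?thesis using assms(2) unfolding eventually_sequentially by (intro exI[of _ N]) force
qed

text \<open>An infinite product forces the products of any two representatives to diverge, in
  particular along the diagonal. Conversely, unlike an inner point, a boundary point has
  self-distance 0: the detour through a late term \<open>x n\<close> costs twice an arbitrarily
  small amount.\<close>

lemma rho_boundary_eq_0_iff:
  assumes "\<xi> \<in> boundary x0" "\<eta> \<in> boundary x0"
  shows "rho x0 b \<xi> \<eta> = 0 \<longleftrightarrow> \<xi> = \<eta>"
proof
  assume 0: "rho x0 b \<xi> \<eta> = 0"
  from assms obtain x y where x: "gromov_seq x0 x" "\<xi> = limit_pt x" and y: "gromov_seq x0 y" "\<eta> = limit_pt y"
    unfolding boundary_iff by auto
  have mem: "x \<in> rep_seqs \<xi>" "y \<in> rep_seqs \<eta>"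
    using x y equiv_class_self[OF equiv_gromov_rel] by auto
  have "gromov_prod_ext x0 \<xi> \<eta> \<le> Liminf (sequentially \<times>\<^sub>F sequentially) (\<lambda>(n, m). ereal (gromov_prod x0 (x n) (y m)))"
    unfolding gromov_prod_ext_def using mem by (intro INF_lower2[of "(x, y)"]) auto
  then have inf: "Liminf (sequentially \<times>\<^sub>F sequentially) (\<lambda>(n, m). ereal (gromov_prod x0 (x n) (y m))) = \<infinity>"
    using 0 b by (simp add: rho_eq_0_iff)
  have "filterlim (\<lambda>n. gromov_prod x0 (x n) (y n)) at_top sequentially"
    unfolding filterlim_at_top_dense
  proof
    fix Z :: real
    have "\<forall>\<^sub>F p in sequentially \<times>\<^sub>F sequentially. ereal Z < (case p of (n, m) \<Rightarrow> ereal (gromov_prod x0 (x n) (y m)))"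
      using inf le_Liminf_iff[of \<infinity> "sequentially \<times>\<^sub>F sequentially"
          "\<lambda>(n, m). ereal (gromov_prod x0 (x n) (y m))"] by simp
    then show "\<forall>\<^sub>F n in sequentially. Z < gromov_prod x0 (x n) (y n)"
      unfolding eventually_prod_sequentially eventually_sequentially by auto
  qed
  then have "(x, y) \<in> gromov_rel x0" using x y by (simp add: gromov_rel_def)
  then show "\<xi> = \<eta>" using x y limit_pt_eq_iff by simp
next
  assume "\<xi> = \<eta>"
  then obtain x where x: "gromov_seq x0 x" "\<xi> = limit_pt x" "\<eta> = limit_pt x"
    using assms unfolding boundary_iff by auto
  have "rho x0 b \<xi> \<eta> \<le> e" if "0 < e" for e
  proof -
    have "\<forall>\<^sub>F n in sequentially. rho x0 b (Inner (x n)) (limit_pt x) < e / 2"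
      by (rule rho_limit_pt_tendsto[OF x(1) half_gt_zero[OF that]])
    then obtain n where "rho x0 b (Inner (x n)) \<xi> < e / 2"
      using x by (auto simp: eventually_sequentially)
    then show ?thesis using rho_triangle[of \<xi> "Inner (x n)" \<eta>] assms \<open>\<xi> = \<eta>\<close>
      by (simp add: boundary_bord rho_commute[of _ _ _ "Inner (x n)"])
  qed
  then show "rho x0 b \<xi> \<eta> = 0"
    using rho_nonneg[of x0 b \<xi> \<eta>] by (intro order.antisym[OF dense_ge]) auto
qed

lemma Metric_space_boundary: "Metric_space (boundary x0) (rho x0 b)"
  unfolding Metric_space_def
  by (intro conjI allI impI rho_nonneg rho_commute rho_boundary_eq_0_iff rho_triangle boundary_bord)

text \<open>If both legs are measured by \<open>rho\<close>, this is strong hyperbolicity. A leg not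
  measured by \<open>rho\<close> is either trivial or joins two inner points at cost
  \<open>ln b * dist\<close>, and by \<open>rho_lipschitz\<close> that cost covers the change which
  moving the end point makes in either term of the minimum.\<close>

lemma bord_metric_triangle:
  assumes "\<xi> \<in> bord x0" "\<eta> \<in> bord x0" "\<zeta> \<in> bord x0"
  shows "bord_metric x0 b \<xi> \<zeta> \<le> bord_metric x0 b \<xi> \<eta> + bord_metric x0 b \<eta> \<zeta>"
proof -
  have *: "bord_metric x0 b (Inner x) \<zeta> \<le> ln b * dist x y + bord_metric x0 b (Inner y) \<zeta>" for x y \<zeta>
  proof (cases \<zeta>)
    case (Inner z)
    have "ln b * dist x z \<le> ln b * dist x y + ln b * dist y z"
      using b dist_triangle[of x z y] by (simp flip: distrib_left)
    then show ?thesis using rho_lipschitz[OF b, of x0 x \<zeta> y] Inner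
      by (auto simp: bord_metric_eq[OF b] min_def)
  next
    case (Bdry c)
    then show ?thesis using rho_lipschitz[OF b, of x0 x \<zeta> y] b
      by (simp add: bord_metric_eq)
  qed
  have mixed: "bord_metric x0 b \<xi> \<zeta> \<le> bord_metric x0 b \<xi> \<eta> + bord_metric x0 b \<eta> \<zeta>"
    if "bord_metric x0 b \<xi> \<eta> \<noteq> rho x0 b \<xi> \<eta>" for \<xi> \<eta> \<zeta>
    using that *
    by (rule_tac bord_edist_cases[of \<xi> \<eta>]) (auto simp: bord_metric_eq[OF b] bord_metric_nonneg[OF b] min_def split: if_splits)
  show ?thesis
  proof (cases "bord_metric x0 b \<xi> \<eta> = rho x0 b \<xi> \<eta> \<and> bord_metric x0 b \<eta> \<zeta> = rho x0 b \<eta> \<zeta>")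
    case True
    then show ?thesis
      using rho_triangle[OF assms] bord_metric_le_rho[OF b, of x0 \<xi> \<zeta>] by simp
  next
    case False
    then show ?thesis
      using mixed[of \<xi> \<eta> \<zeta>] mixed[of \<zeta> \<eta> \<xi>]
      by (auto simp: bord_metric_commute[of x0 b \<zeta>] bord_metric_commute[of x0 b \<eta> \<xi>] rho_commute[of x0 b \<zeta>])
  qed
qed

section \<open>The action on the bordification and the metric on the isometry group\<close>

lemma vis_isometry_le:
  assumes "g \<in> isometries"
  shows "vis (g x) (g y) \<le> b powr dist (g x0) x0 * vis x y"
proof -
  have "gromov_prod x0 x y \<le> gromov_prod x0 (g x) (g y) + dist (g x0) x0"
    using gromov_prod_base_lipschitz[of "g x0" "g x" "g y" x0] isometries_gromov_prod[OF assms] by simp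
  then have "vis (g x) (g y) \<le> b powr (dist (g x0) x0 + - gromov_prod x0 x y)"
    using b by (intro powr_mono) auto
  then show ?thesis unfolding powr_add .
qed

text \<open>Moving the base point by \<open>dist (g x0) x0\<close> changes Gromov products by at
  most that much. Hence an isometry is Lipschitz for \<open>vis\<close>, which is enough to preserve
  the Cauchy condition and equivalence.\<close>

lemma isometry_gromov_rel:
  assumes g: "g \<in> isometries" and "(x, y) \<in> gromov_rel x0"
  shows "(g \<circ> x, g \<circ> y) \<in> gromov_rel x0"
proof -
  define k where "k = b powr dist (g x0) x0"
  have k: "0 < k" "vis (g x) (g y) \<le> k * vis x y" for x y
    using b vis_isometry_le[OF g] by (auto simp: k_def)
  have small: "vis (g x) (g y) < e" if "vis x y < e / k" for x y e
    using k(2)[of x y] that k(1) by (simp add: pos_less_divide_eq mult.commute)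
  have seq: "gromov_seq x0 (g \<circ> x)" if "gromov_seq x0 x" for x
    unfolding gromov_seq_iff
  proof (intro allI impI)
    fix e :: real assume "0 < e"
    then have "0 < e / k" using k(1) by simp
    with that obtain N where "\<forall>m\<ge>N. \<forall>n\<ge>N. vis (x m) (x n) < e / k"
      unfolding gromov_seq_iff by blast
    then show "\<exists>N. \<forall>m\<ge>N. \<forall>n\<ge>N. vis ((g \<circ> x) m) ((g \<circ> x) n) < e"
      using small by (intro exI[of _ N]) auto
  qed
  have "\<forall>\<^sub>F n in sequentially. vis ((g \<circ> x) n) ((g \<circ> y) n) < e" if "0 < e" for e
  proof -
    have "\<forall>\<^sub>F n in sequentially. vis (x n) (y n) < e / k"
      using assms(2) that k(1) by (simp add: gromov_rel_iff)
    then show ?thesis by eventually_elim (simp add: small)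
  qed
  then show ?thesis using seq assms(2) by (auto simp: gromov_rel_iff)
qed

lemma bord_act_bord:
  assumes "g \<in> isometries" "\<xi> \<in> bord x0"
  shows "bord_act x0 g \<xi> \<in> bord x0"
proof (cases \<xi>)
  case (Bdry c)
  then obtain x where x: "gromov_seq x0 x" "c = gromov_rel x0 `` {x}"
    using assms(2) boundary_iff by (auto simp: bord_def)
  then have xx: "(x, x) \<in> gromov_rel x0"
    using equiv_class_self[OF equiv_gromov_rel] by auto
  have eq: "gromov_rel x0 `` {g \<circ> y} = gromov_rel x0 `` {g \<circ> x}" if "y \<in> c" for y
    using that x isometry_gromov_rel[OF assms(1), of x y]
    by (intro equiv_class_eq[OF equiv_gromov_rel, symmetric]) auto
  have "x \<in> c" using xx x by simp
  have "(\<Union>y\<in>c. gromov_rel x0 `` {g \<circ> y}) = (\<Union>y\<in>c. gromov_rel x0 `` {g \<circ> x})"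
    by (rule SUP_cong[OF refl eq])
  also have "\<dots> = gromov_rel x0 `` {g \<circ> x}" using \<open>x \<in> c\<close> by blast
  finally have "(\<Union>y\<in>c. gromov_rel x0 `` {g \<circ> y}) = gromov_rel x0 `` {g \<circ> x}" .
  moreover have "gromov_seq x0 (g \<circ> x)"
    using isometry_gromov_rel[OF assms(1) xx] by (simp add: gromov_rel_iff)
  ultimately have "bord_act x0 g \<xi> \<in> boundary x0" using Bdry boundary_iff by auto
  then show ?thesis by (rule boundary_bord)
qed auto

lemma isom_dist_upper:
  assumes "\<xi> \<in> bord x0"
  shows "bord_metric x0 b (bord_act x0 g1 \<xi>) (bord_act x0 g2 \<xi>) \<le> isom_dist x0 b g1 g2"
    and "bord_metric x0 b (bord_act x0 (inv g1) \<xi>) (bord_act x0 (inv g2) \<xi>) \<le> isom_dist x0 b g1 g2"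
  unfolding isom_dist_def
  by (intro max.coboundedI1 max.coboundedI2 cSUP_upper assms bdd_aboveI2[of _ _ 1] bord_metric_le_1 b)+

lemma isom_dist_least:
  assumes "\<And>\<xi>. \<xi> \<in> bord x0 \<Longrightarrow> bord_metric x0 b (bord_act x0 g1 \<xi>) (bord_act x0 g2 \<xi>) \<le> c"
    and "\<And>\<xi>. \<xi> \<in> bord x0 \<Longrightarrow> bord_metric x0 b (bord_act x0 (inv g1) \<xi>) (bord_act x0 (inv g2) \<xi>) \<le> c"
  shows "isom_dist x0 b g1 g2 \<le> c"
proof -
  have "bord x0 \<noteq> {}" by (auto simp: bord_def)
  then show ?thesis unfolding isom_dist_def by (intro max.boundedI cSUP_least assms)
qed

lemma isom_dist_nonneg: "0 \<le> isom_dist x0 b g1 g2"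
  using isom_dist_upper(1)[OF Inner_bord] bord_metric_nonneg[OF b] by (rule order_trans[rotated])

lemma isom_dist_self: "isom_dist x0 b g g = 0"
  by (intro antisym isom_dist_nonneg isom_dist_least) (simp_all add: bord_metric_eq[OF b])

lemma bord_metric_Inner_eq_0: "bord_metric x0 b (Inner x) (Inner y) = 0 \<longleftrightarrow> x = y"
  using b by (auto simp: bord_metric_eq rho_Inner min_def)

lemma Metric_space_isometries: "Metric_space isometries (isom_dist x0 b)"
  unfolding Metric_space_def
proof (intro conjI allI impI)
  fix g h :: "'x \<Rightarrow> 'x"
  show "0 \<le> isom_dist x0 b g h" by (rule isom_dist_nonneg)
  have swap: "bord_metric x0 b (bord_act x0 g \<xi>) (bord_act x0 h \<xi>)
      = bord_metric x0 b (bord_act x0 h \<xi>) (bord_act x0 g \<xi>)" for g h \<xi>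
    by (rule bord_metric_commute)
  show "isom_dist x0 b g h = isom_dist x0 b h g"
    unfolding isom_dist_def by (simp only: swap[of g _ h] swap[of "inv g" _ "inv h"])
  show "isom_dist x0 b g h = 0 \<longleftrightarrow> g = h"
  proof
    assume "isom_dist x0 b g h = 0"
    then have "bord_metric x0 b (Inner (g x)) (Inner (h x)) \<le> 0" for x
      using isom_dist_upper(1)[OF Inner_bord, of g x h] by simp
    then have "bord_metric x0 b (Inner (g x)) (Inner (h x)) = 0" for x
      using bord_metric_nonneg[OF b] by (intro antisym)
    then show "g = h" unfolding bord_metric_Inner_eq_0 by auto
  qed (simp add: isom_dist_self)
next
  fix f g h :: "'x \<Rightarrow> 'x" assume *: "f \<in> isometries" "g \<in> isometries" "h \<in> isometries"
  show "isom_dist x0 b f h \<le> isom_dist x0 b f g + isom_dist x0 b g h"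
  proof (rule isom_dist_least)
    fix \<xi> assume \<xi>: "\<xi> \<in> bord x0"
    show "bord_metric x0 b (bord_act x0 f \<xi>) (bord_act x0 h \<xi>) \<le> isom_dist x0 b f g + isom_dist x0 b g h"
      using isom_dist_upper(1)[OF \<xi>, of f g] isom_dist_upper(1)[OF \<xi>, of g h]
        bord_metric_triangle[OF bord_act_bord[OF *(1) \<xi>] bord_act_bord[OF *(2) \<xi>] bord_act_bord[OF *(3) \<xi>]]
      by linarith
    show "bord_metric x0 b (bord_act x0 (inv f) \<xi>) (bord_act x0 (inv h) \<xi>) \<le> isom_dist x0 b f g + isom_dist x0 b g h"
      using isom_dist_upper(2)[OF \<xi>, of f g] isom_dist_upper(2)[OF \<xi>, of g h]
        bord_metric_triangle[OF bord_act_bord[OF inv_isometries[OF *(1)] \<xi>]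
          bord_act_bord[OF inv_isometries[OF *(2)] \<xi>] bord_act_bord[OF inv_isometries[OF *(3)] \<xi>]]
      by linarith
  qed
qed

text \<open>The supremum is tested at the inner point \<open>y\<close> only. If the metric term is
  the minimum, the bound holds with room to spare. Otherwise \<open>isom_dist\<close> is at least
  b^(-r), and the trivial bound \<open>2 * r\<close> on the distance suffices because
  \<open>ln b * r\<close> is at most b^r; the two factors b^r make up
  \<open>b powr (2 * r)\<close>.\<close>

lemma dist_le_isom_dist:
  assumes "dist (g1 y) x0 \<le> r" "dist (g2 y) x0 \<le> r"
  shows "dist (g1 y) (g2 y) \<le> 2 / ln b * b powr (2 * r) * isom_dist x0 b g1 g2"
proof -
  let ?d = "dist (g1 y) (g2 y)" and ?D = "isom_dist x0 b g1 g2"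
  have r: "0 \<le> r" using assms(1) zero_le_dist order_trans by blast
  have lb: "0 < ln b" using b by simp
  have "min (ln b * ?d) (vis (g1 y) (g2 y)) \<le> ?D"
    using isom_dist_upper(1)[OF Inner_bord, of g1 y g2] by (simp add: bord_metric_eq[OF b] rho_Inner)
  then consider "ln b * ?d \<le> ?D" | "vis (g1 y) (g2 y) \<le> ?D" by linarith
  then show ?thesis
  proof cases
    case 1
    have "1 * (ln b * ?d) \<le> (2 * b powr (2 * r)) * ?D"
      using 1 b r powr_mono[of 0 "2 * r" b] isom_dist_nonneg[of g1 g2] lb by (intro mult_mono) auto
    then show ?thesis using lb by (simp add: field_simps)
  next
    case 2
    have "b powr - r \<le> vis (g1 y) (g2 y)"
      using gromov_prod_le_dist[of x0 "g1 y" "g2 y"] assms b by (intro powr_mono) auto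
    with 2 have D: "b powr - r \<le> ?D" by simp
    have "ln b * r \<le> exp (ln b * r)"
      using exp_ge_add_one_self[of "ln b * r"] by linarith
    then have "ln b * r \<le> b powr r" using b by (simp add: powr_def mult.commute)
    moreover have "?d \<le> 2 * r" using assms dist_triangle2[of "g1 y" "g2 y" x0] by simp
    moreover from this have "ln b * ?d \<le> ln b * (2 * r)" using lb by (intro mult_left_mono) auto
    ultimately have "ln b * ?d \<le> 2 * b powr r" by (simp add: algebra_simps)
    also have "\<dots> = 2 * b powr (2 * r) * b powr - r"
      by (simp flip: powr_add)
    also have "\<dots> \<le> 2 * b powr (2 * r) * ?D"
      using D by (intro mult_left_mono) auto
    finally show ?thesis using lb by (simp add: field_simps)
  qed
qed

text \<open>Below b^(-r) the visual term cannot be the minimum. Only \<open>g1 y\<close> is required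
  to be near \<open>x0\<close>, so a bound on \<open>g2 y\<close> can be deduced instead of
  assumed.\<close>

lemma dist_le_of_isom_dist_small:
  assumes "dist (g1 y) x0 \<le> r" "isom_dist x0 b g1 g2 < b powr - r"
  shows "dist (g1 y) (g2 y) \<le> isom_dist x0 b g1 g2 / ln b"
proof -
  have "min (ln b * dist (g1 y) (g2 y)) (vis (g1 y) (g2 y)) \<le> isom_dist x0 b g1 g2"
    using isom_dist_upper(1)[OF Inner_bord, of g1 y g2] by (simp add: bord_metric_eq[OF b] rho_Inner)
  moreover have "b powr - r \<le> vis (g1 y) (g2 y)"
    using gromov_prod_le_dist[of x0 "g1 y" "g2 y"] assms(1) b by (intro powr_mono) auto
  ultimately have "ln b * dist (g1 y) (g2 y) \<le> isom_dist x0 b g1 g2"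
    using assms(2) by linarith
  then show ?thesis using b by (simp add: field_simps)
qed

end

section \<open>Real sequences with nearly constant increments\<close>

text \<open>Fekete's lemma. That the limit is also the infimum is what later gives upper
  semicontinuity of the drift.\<close>

lemma subadditive_limit:
  fixes F :: "nat \<Rightarrow> real"
  assumes sub: "\<And>m n. F (m + n) \<le> F m + F n" and nonneg: "\<And>n. 0 \<le> F n"
  obtains L where "(\<lambda>n. F n / real n) \<longlonglongrightarrow> L" "\<And>n. real n * L \<le> F n" "0 \<le> L"
proof -
  define L where "L = (INF n\<in>{1..}. F n / real n)"
  have bdd: "bdd_below ((\<lambda>n. F n / real n) ` {1..})"
    using nonneg by (intro bdd_belowI2[of _ 0]) auto
  have L_le: "L \<le> F n / real n" if "1 \<le> n" for n
    unfolding L_def using that by (intro cINF_lower bdd) auto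
  have "(\<lambda>n. F n / real n) \<longlonglongrightarrow> L"
  proof (rule LIMSEQ_I)
    fix e :: real assume e: "0 < e"
    have "\<exists>m\<in>{1..}. F m / real m < L + e / 2"
      using cINF_less_iff[OF _ bdd, of "L + e / 2"] e by (auto simp: L_def)
    then obtain m where m: "1 \<le> m" "F m / real m < L + e / 2" by auto
    define c where "c = Max (F ` {..<m})"
    have c: "F r \<le> c" if "r < m" for r
      using that by (simp add: c_def)
    have c0: "0 \<le> c" using c[of 0] nonneg[of 0] m by simp
    have mult: "F (k * m + r) \<le> real k * F m + F r" for k r
    proof (induction k)
      case (Suc k)
      then show ?case using sub[of m "k * m + r"] by (simp add: algebra_simps)
    qed simp
    have bound: "F n / real n \<le> F m / real m + c / real n" if "1 \<le> n" for n
    proof -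
      have "F n \<le> real (n div m) * F m + c"
        using mult[of "n div m" "n mod m"] c[of "n mod m"] m by simp
      also have "real (n div m) * F m \<le> (real n / real m) * F m"
        by (intro mult_right_mono nonneg of_nat_div_le_of_nat)
      finally have "F n / real n \<le> (real n / real m * F m + c) / real n"
        by (intro divide_right_mono) auto
      also have "\<dots> = F m / real m + c / real n" using that by (simp add: add_divide_distrib)
      finally show ?thesis .
    qed
    obtain n0 where n0: "c / (e / 2) < real n0" using reals_Archimedean2 by blast
    have "norm (F n / real n - L) < e" if "n \<ge> max 1 n0" for n
    proof -
      have n: "1 \<le> n" "c / (e / 2) < real n" using that n0 by auto
      then have "c / real n < e / 2" using e by (simp add: field_simps)
      then have "F n / real n - L < e" using bound[OF n(1)] m(2) by argo
      then show ?thesis using L_le[OF n(1)] by simp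
    qed
    then show "\<exists>no. \<forall>n\<ge>no. norm (F n / real n - L) < e" by blast
  qed
  moreover have "real n * L \<le> F n" for n
    using L_le[of n] nonneg[of 0] by (cases "n = 0") (auto simp: field_simps)
  moreover have "0 \<le> L" unfolding L_def using nonneg by (intro cINF_greatest) auto
  ultimately show ?thesis using that by blast
qed

text \<open>The hypothesis is confined to indices below \<open>m\<close>: in the bootstrap the bound
  at \<open>k\<close> becomes available only once linear growth up to \<open>k\<close> has been
  shown.\<close>

lemma geometric_increments:
  fixes a :: "nat \<Rightarrow> real"
  assumes "\<And>k. n \<le> k \<Longrightarrow> k < m \<Longrightarrow> \<bar>a k - a (Suc k)\<bar> \<le> K * q ^ k"
    and "n \<le> m" "0 < q" "q < 1" "0 \<le> K"
  shows "\<bar>a m - a n\<bar> \<le> K * q ^ n / (1 - q)"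
proof -
  \<comment> \<open>Keeping the subtracted term \<open>q ^ m\<close> makes the induction
    telescope.\<close>
  have "\<bar>a m - a n\<bar> \<le> K * (q ^ n - q ^ m) / (1 - q)"
    using assms(2,1)
  proof (induction m rule: dec_induct)
    case (step k)
    have "\<bar>a (Suc k) - a n\<bar> \<le> K * (q ^ n - q ^ k) / (1 - q) + K * q ^ k"
      using step.IH step.prems(1)[of k] step.prems step.hyps by fastforce
    also have "\<dots> = K * (q ^ n - q ^ Suc k) / (1 - q)"
      using assms by (simp add: field_simps)
    finally show ?case .
  qed simp
  also have "\<dots> \<le> K * q ^ n / (1 - q)"
    using assms by (intro divide_right_mono mult_left_mono) auto
  finally show ?thesis .
qed

text \<open>Beyond \<open>n\<close> every increment is within \<open>h\<close> of the one at
  \<open>n\<close>, so F m is an affine function of m up to an error of (m - n) h. Division by m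
  removes the fixed offset, whatever its size.\<close>

lemma average_limit_near_increment:
  fixes F :: "nat \<Rightarrow> real"
  assumes lim: "(\<lambda>n. F n / real n) \<longlonglongrightarrow> L"
    and near: "\<And>m. n \<le> m \<Longrightarrow> \<bar>(F (Suc m) - F m) - (F (Suc n) - F n)\<bar> \<le> h"
  shows "\<bar>L - (F (Suc n) - F n)\<bar> \<le> h"
proof -
  define a where "a = F (Suc n) - F n"
  have bnd: "\<bar>F m - (F n + real (m - n) * a)\<bar> \<le> real (m - n) * h" if "n \<le> m" for m
    using that
  proof (induction m rule: dec_induct)
    case (step k)
    have "F (Suc k) - (F n + real (Suc k - n) * a)
        = (F k - (F n + real (k - n) * a)) + ((F (Suc k) - F k) - a)"
      using step.hyps by (simp add: Suc_diff_le algebra_simps)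
    then show ?case using step near[OF step.hyps(1)]
      by (simp add: Suc_diff_le algebra_simps a_def[symmetric])
  qed simp
  have to: "(\<lambda>m. (F n + real (m - n) * c) / real m) \<longlonglongrightarrow> c" for c
  proof -
    have "(\<lambda>m. (F n - real n * c) / real m + c) \<longlonglongrightarrow> 0 + c"
      by (intro tendsto_add tendsto_const lim_const_over_n)
    moreover have "\<forall>\<^sub>F m in sequentially. (F n - real n * c) / real m + c = (F n + real (m - n) * c) / real m"
      using eventually_ge_at_top[of "Suc n"]
      by eventually_elim (simp add: field_simps of_nat_diff)
    ultimately show ?thesis using filterlim_cong[OF refl refl] by force
  qed
  have "L \<le> a + h"
  proof (rule LIMSEQ_le[OF lim to], intro exI[of _ n] allI impI divide_right_mono)
    fix m assume "n \<le> m"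
    then show "F m \<le> F n + real (m - n) * (a + h)" using bnd[of m] by (simp add: algebra_simps)
  qed simp
  moreover have "a - h \<le> L"
  proof (rule LIMSEQ_le[OF to lim], intro exI[of _ n] allI impI divide_right_mono)
    fix m assume "n \<le> m"
    then show "F n + real (m - n) * (a - h) \<le> F m" using bnd[of m] by (simp add: algebra_simps)
  qed simp
  ultimately show ?thesis by (simp add: a_def abs_le_iff)
qed

text \<open>The step bound is conditional on the growth that is being proved. Once growth is known
  up to m, the increment at m differs from the one at \<open>n\<close> by at most
  \<open>K * q ^ n / (1 - q)\<close>, a quantity independent of m; the reserve in the last starting
  condition pays for it at every stage.\<close>

lemma linear_growth_bootstrap:
  fixes F :: "nat \<Rightarrow> real"
  assumes step: "\<And>k. N \<le> k \<Longrightarrow> real k * l \<le> F k \<Longrightarrow>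
      \<bar>(F (Suc k) - F k) - (F (Suc (Suc k)) - F (Suc k))\<bar> \<le> K * q ^ k"
    and start: "N \<le> n" "\<And>k. N \<le> k \<Longrightarrow> k \<le> n \<Longrightarrow> real k * l \<le> F k"
      "l + K * q ^ n / (1 - q) \<le> F (Suc n) - F n"
    and q: "0 < q" "q < 1" "0 \<le> K" and "N \<le> k"
  shows "real k * l \<le> F k"
proof -
  have "\<forall>k. N \<le> k \<longrightarrow> k \<le> m \<longrightarrow> real k * l \<le> F k" if "n \<le> m" for m
    using that
  proof (induction m rule: dec_induct)
    case (step m)
    have "\<bar>(F (Suc m) - F m) - (F (Suc n) - F n)\<bar> \<le> K * q ^ n / (1 - q)"
      using step start q assms(1) by (intro geometric_increments[of n m "\<lambda>k. F (Suc k) - F k"]) auto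
    then have "l \<le> F (Suc m) - F m" using start(3) by linarith
    moreover have "real m * l \<le> F m" using step start(1) by auto
    ultimately have "real (Suc m) * l \<le> F (Suc m)" by (simp add: algebra_simps)
    then show ?case using step.IH by (auto simp: le_Suc_eq)
  qed (use start in auto)
  then show ?thesis using \<open>N \<le> k\<close> by (meson le_cases order_refl)
qed

text \<open>The scale \<open>n\<close> is chosen such that \<open>B ^ n\<close> is about \<open>1 / sqrt t\<close>.\<close>

lemma optimise_scale:
  fixes q B K :: real
  assumes q: "0 < q" "q < 1" and B: "1 < B" and K: "0 \<le> K"
  obtains \<alpha> K' where "0 < \<alpha>" "0 < K'"
    "\<And>t A. 0 \<le> t \<Longrightarrow> t \<le> 1 \<Longrightarrow> (\<And>n. N \<le> n \<Longrightarrow> A \<le> K * (q ^ n + B ^ n * t)) \<Longrightarrow> A \<le> K' * t powr \<alpha>"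
proof -
  \<comment> \<open>With B^s = t^(-1/2), the growing term B^s t equals t^(1/2), and q^s is t to the
    second exponent.\<close>
  define \<alpha> where "\<alpha> = min (1 / 2) (- ln q / (2 * ln B))"
  \<comment> \<open>The factor \<open>1 / q\<close> pays for rounding s down to an integer j and
    \<open>B ^ N\<close> for using the admissible scale N + j; the summand 1 keeps the constant
    positive when \<open>K\<close> is 0.\<close>
  define K' where "K' = K * (1 / q + B ^ N) + 1"
  have "0 < - ln q / (2 * ln B)" using q B by (simp add: divide_neg_pos)
  then have \<alpha>: "0 < \<alpha>" by (simp add: \<alpha>_def)
  have K': "0 < K'" using q B K by (simp add: K'_def add_nonneg_pos)
  have "A \<le> K' * t powr \<alpha>"
    if t: "0 \<le> t" "t \<le> 1" and A: "\<And>n. N \<le> n \<Longrightarrow> A \<le> K * (q ^ n + B ^ n * t)" for t A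
  \<comment> \<open>For t = 0 there is no optimal scale, and n tends to infinity instead.\<close>
  proof (cases "t = 0")
    case True
    have "(\<lambda>n. K * q ^ n) \<longlonglongrightarrow> K * 0"
      using q by (intro tendsto_mult tendsto_const LIMSEQ_power_zero) auto
    then have "A \<le> 0" using A True by (intro LIMSEQ_le_const) auto
    then show ?thesis using True by simp
  next
    case False
    then have t0: "0 < t" using t by simp
    define s where "s = - ln t / (2 * ln B)"
    have s0: "0 \<le> s" using t0 t B by (simp add: s_def divide_nonpos_pos)
    define j where "j = nat \<lfloor>s\<rfloor>"
    have j: "real j \<le> s" "s - 1 \<le> real j" using s0 by (auto simp: j_def)
    have "B ^ j \<le> B powr s"
      using j(1) B by (simp add: powr_realpow[symmetric])
    also have "\<dots> = t powr - (1 / 2)"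
      using B t0 by (simp add: powr_def s_def)
    finally have "B ^ j * t \<le> t powr - (1 / 2) * t powr 1" using t0 by (simp add: mult_right_mono)
    also have "\<dots> = t powr (1 / 2)" by (simp only: powr_add[symmetric]) simp
    also have "\<dots> \<le> t powr \<alpha>" using t0 t by (intro powr_mono') (auto simp: \<alpha>_def)
    finally have 1: "B ^ (N + j) * t \<le> B ^ N * t powr \<alpha>"
      using B by (simp add: power_add mult.assoc)
    have "q ^ j \<le> q powr (s - 1)"
      using j(2) q by (simp add: powr_realpow[symmetric] powr_mono')
    also have "\<dots> = 1 / q * q powr s" using q by (simp add: powr_diff)
    also have "q powr s = t powr (- ln q / (2 * ln B))"
      using q t0 by (simp add: powr_def s_def mult.commute)
    also have "\<dots> \<le> t powr \<alpha>" using t0 t by (intro powr_mono') (auto simp: \<alpha>_def)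
    finally have "q ^ j \<le> 1 / q * t powr \<alpha>" using q by (simp add: divide_right_mono)
    moreover have "q ^ (N + j) \<le> q ^ j" using q by (intro power_decreasing) auto
    ultimately have 2: "q ^ (N + j) \<le> 1 / q * t powr \<alpha>" by linarith
    have "A \<le> K * (q ^ (N + j) + B ^ (N + j) * t)" by (rule A) simp
    also have "\<dots> \<le> K * (1 / q * t powr \<alpha> + B ^ N * t powr \<alpha>)"
      using 1 2 K by (intro mult_left_mono add_mono) auto
    also have "\<dots> \<le> K' * t powr \<alpha>" by (simp add: K'_def algebra_simps)
    finally show ?thesis .
  qed
  with \<alpha> K' show ?thesis using that by blast
qed

section \<open>Cocycles over a measure-preserving system\<close>

lemma separable_dense_sequence:
  assumes "separable_space (euclidean :: 'x::metric_space topology)"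
  obtains e :: "nat \<Rightarrow> 'x::metric_space" where "\<And>x r. 0 < r \<Longrightarrow> \<exists>i. dist (e i) x < r"
proof -
  obtain C :: "'x set" where C: "countable C" "closure C = UNIV"
    using assms by (auto simp: separable_space_def)
  then have "C \<noteq> {}" by auto
  with C have "range (from_nat_into C) = C" by (simp add: range_from_nat_into)
  then have "\<exists>i. dist (from_nat_into C i) x < r" if "0 < r" for x r
    using C(2) that closure_approachable[of x C] by (metis UNIV_I imageE)
  then show ?thesis using that by blast
qed

text \<open>A point of the dense sequence close to \<open>y\<close> shows that
  \<open>dist (y \<omega>) (z \<omega>) < a\<close> is a countable disjunction of conditions on
  distances to fixed points, each of which is continuous in one variable.\<close>

lemma borel_measurable_dist_separable:
  fixes y z :: "'w \<Rightarrow> 'x::metric_space"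
  assumes sep: "separable_space (euclidean :: 'x topology)"
    and y: "y \<in> borel_measurable M" and z: "z \<in> borel_measurable M"
  shows "(\<lambda>\<omega>. dist (y \<omega>) (z \<omega>)) \<in> borel_measurable M"
proof -
  obtain e :: "nat \<Rightarrow> 'x" where e: "\<And>x r. 0 < r \<Longrightarrow> \<exists>i. dist (e i) x < r"
    using separable_dense_sequence[OF sep] by blast
  have d: "(\<lambda>\<omega>. dist (e i) (u \<omega>)) \<in> borel_measurable M" if "u \<in> borel_measurable M" for u i
    by (rule measurable_compose[OF that], rule borel_measurable_continuous_onI) (intro continuous_intros)
  show ?thesis
    unfolding borel_measurable_iff_less
  proof
    fix a :: real
    have eq: "dist (y \<omega>) (z \<omega>) < a \<longleftrightarrow> (\<exists>i. dist (e i) (y \<omega>) + dist (e i) (z \<omega>) < a)" for \<omega>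
    proof
      assume "dist (y \<omega>) (z \<omega>) < a"
      then obtain i where i: "dist (e i) (y \<omega>) < (a - dist (y \<omega>) (z \<omega>)) / 2"
        using e[of "(a - dist (y \<omega>) (z \<omega>)) / 2" "y \<omega>"] by auto
      then have "dist (e i) (y \<omega>) + dist (e i) (z \<omega>) < a"
        using dist_triangle[of "e i" "z \<omega>" "y \<omega>"] by (simp add: field_simps)
      then show "\<exists>i. dist (e i) (y \<omega>) + dist (e i) (z \<omega>) < a" ..
    next
      assume "\<exists>i. dist (e i) (y \<omega>) + dist (e i) (z \<omega>) < a"
      then obtain i where "dist (e i) (y \<omega>) + dist (e i) (z \<omega>) < a" ..
      then show "dist (y \<omega>) (z \<omega>) < a"
        using dist_triangle3[of "y \<omega>" "z \<omega>" "e i"] by linarith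
    qed
    have "{\<omega> \<in> space M. dist (y \<omega>) (z \<omega>) < a}
        = (\<Union>i. {\<omega> \<in> space M. dist (e i) (y \<omega>) + dist (e i) (z \<omega>) < a})"
      unfolding eq by auto
    also have "\<dots> \<in> sets M"
      using d[OF y] d[OF z] by measurable
    finally show "{\<omega> \<in> space M. dist (y \<omega>) (z \<omega>) < a} \<in> sets M" .
  qed
qed

lemma cocycle_add:
  "cocycle T g (m + n) \<omega> = cocycle T g m \<omega> \<circ> cocycle T g n ((T ^^ m) \<omega>)"
proof (induction n)
  case (Suc n)
  have "(T ^^ (m + n)) \<omega> = (T ^^ n) ((T ^^ m) \<omega>)"
    by (simp add: funpow_add add.commute[of m])
  then show ?case using Suc by (simp add: comp_assoc)
qed simp

lemma cocycle_Suc_left: "cocycle T g (Suc n) \<omega> = g \<omega> \<circ> cocycle T g n (T \<omega>)"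
  using cocycle_add[of T g 1 n \<omega>] by simp

lemma space_metric_borel: "space (metric_borel A d) = A"
  by (simp add: metric_borel_def space_measure_of_conv)

lemma cocycle_isometries:
  assumes "\<And>k. g ((T ^^ k) \<omega>) \<in> isometries"
  shows "cocycle T g n \<omega> \<in> isometries"
proof (induction n)
  case 0
  show ?case unfolding cocycle.simps by (rule id_isometries)
next
  case (Suc n)
  then show ?case unfolding cocycle.simps using assms by (rule isometries_comp)
qed

locale cocycle_system = strongly_hyperbolic_space x0 b + prob_space M
  for x0 :: "'x::metric_space" and b :: real and M :: "'w measure" +
  fixes T :: "'w \<Rightarrow> 'w"
  assumes T [measurable]: "T \<in> M \<rightarrow>\<^sub>M M" and T_preserves: "distr M M T = M"
    and sep: "separable_space (euclidean :: 'x topology)"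
begin

section \<open>Measurability of orbits and invariance under the dynamics\<close>

abbreviation isom_measurable :: "('w \<Rightarrow> 'x \<Rightarrow> 'x) \<Rightarrow> bool" where
  "isom_measurable g \<equiv> g \<in> M \<rightarrow>\<^sub>M metric_borel isometries (isom_dist x0 b)"

lemma isom_measurable_isometry: "isom_measurable g \<Longrightarrow> \<omega> \<in> space M \<Longrightarrow> g \<omega> \<in> isometries"
  using measurable_space[of g M "metric_borel isometries (isom_dist x0 b)" \<omega>]
  by (simp add: space_metric_borel)

text \<open>Evaluation at a point is continuous for \<open>isom_dist\<close>, so preimages of open
  sets are open in the group.\<close>

lemma isometry_eval_measurable:
  assumes g: "isom_measurable g"
  shows "(\<lambda>\<omega>. g \<omega> x) \<in> borel_measurable M"
proof (rule borel_measurableI)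
  fix S :: "'x set" assume S: "open S"
  interpret I: Metric_space isometries "isom_dist x0 b" by (rule Metric_space_isometries)
  define U where "U = {h \<in> isometries. h x \<in> S}"
  have "openin I.mtopology U"
    unfolding I.openin_mtopology
  proof (intro conjI allI impI)
    fix h assume h: "h \<in> U"
    then obtain e where e: "0 < e" "\<And>z. dist z (h x) < e \<Longrightarrow> z \<in> S"
      using S unfolding U_def open_dist by blast
    \<comment> \<open>The first bound excludes the visual term as the minimum; the second then keeps
      \<open>f x\<close> within \<open>e\<close> of \<open>h x\<close>.\<close>
    define r where "r = min (b powr - dist (h x) x0) (e * ln b)"
    have "r > 0" using e b by (simp add: r_def)
    moreover have "I.mball h r \<subseteq> U"
    proof
      fix f assume "f \<in> I.mball h r"
      then have f: "f \<in> isometries" "isom_dist x0 b h f < b powr - dist (h x) x0"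
        "isom_dist x0 b h f < e * ln b"
        by (auto simp: r_def)
      have "dist (h x) (f x) \<le> isom_dist x0 b h f / ln b"
        by (rule dist_le_of_isom_dist_small[OF order_refl f(2)])
      also have "\<dots> < e" using f(3) b by (simp add: divide_less_eq)
      finally show "f \<in> U" using e(2)[of "f x"] f(1) by (simp add: U_def dist_commute)
    qed
    ultimately show "\<exists>r>0. I.mball h r \<subseteq> U" by blast
  qed (auto simp: U_def)
  then have "U \<in> sets (metric_borel isometries (isom_dist x0 b))"
    unfolding metric_borel_def using openin_subset[of I.mtopology]
    by (subst sets_measure_of) (auto simp: I.topspace_mtopology)
  then have "g -` U \<inter> space M \<in> sets M" by (rule measurable_sets[OF g])
  also have "g -` U \<inter> space M = (\<lambda>\<omega>. g \<omega> x) -` S \<inter> space M"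
    using isom_measurable_isometry[OF g] by (auto simp: U_def)
  finally show "(\<lambda>\<omega>. g \<omega> x) -` S \<inter> space M \<in> sets M" .
qed

text \<open>The moving point is approximated by countably valued functions, the least admissible
  index being measurable. As \<open>g \<omega>\<close> is an isometry, the approximation error is
  unchanged after evaluation.\<close>

lemma isometry_eval_measurable2:
  assumes g: "isom_measurable g" and y: "y \<in> borel_measurable M"
  shows "(\<lambda>\<omega>. g \<omega> (y \<omega>)) \<in> borel_measurable M"
proof -
  obtain e :: "nat \<Rightarrow> 'x" where e: "\<And>x r. 0 < r \<Longrightarrow> \<exists>i. dist (e i) x < r"
    using separable_dense_sequence[OF sep] by blast
  define idx where "idx k \<omega> = (LEAST i. dist (e i) (y \<omega>) < 1 / real (Suc k))" for k \<omega>
  have idx: "dist (e (idx k \<omega>)) (y \<omega>) < 1 / real (Suc k)" for k \<omega>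
    unfolding idx_def using e[of "1 / real (Suc k)" "y \<omega>"] by (rule LeastI_ex) simp
  have d: "(\<lambda>\<omega>. dist (e i) (y \<omega>)) \<in> borel_measurable M" for i
    by (rule borel_measurable_dist_separable[OF sep _ y]) simp
  have "idx k \<in> M \<rightarrow>\<^sub>M count_space UNIV" for k
    unfolding idx_def using d by measurable
  then have "(\<lambda>\<omega>. g \<omega> (e (idx k \<omega>))) \<in> borel_measurable M" for k
    by (rule measurable_compose_countable[rotated]) (rule isometry_eval_measurable[OF g])
  then show ?thesis
  proof (rule borel_measurable_LIMSEQ_metric)
    fix \<omega> assume "\<omega> \<in> space M"
    then have "dist (g \<omega> (e (idx k \<omega>))) (g \<omega> (y \<omega>)) \<le> 1 / real (Suc k)" for k
      using isometriesD(2)[OF isom_measurable_isometry[OF g]] idx[of k \<omega>] by simp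
    then show "(\<lambda>k. g \<omega> (e (idx k \<omega>))) \<longlonglongrightarrow> g \<omega> (y \<omega>)"
      by (subst tendsto_dist_iff, intro tendsto_sandwich[OF _ _ tendsto_const LIMSEQ_Suc[OF lim_1_over_n]])
        (auto simp del: of_nat_Suc)
  qed
qed

lemma cocycle_measurable:
  assumes g: "isom_measurable g"
  shows "(\<lambda>\<omega>. cocycle T g n \<omega> x) \<in> borel_measurable M"
proof (induction n)
  case (Suc n)
  then have "(\<lambda>\<omega>. cocycle T g n (T \<omega>) x) \<in> borel_measurable M"
    by (rule measurable_compose[OF T])
  then show ?case
    \<comment> \<open>With the factor at time 0 split off, the rest is the orbit of the fixed point
      \<open>x\<close> over \<open>T \<omega>\<close>, and only \<open>g\<close> is evaluated at a
      moving point.\<close>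
    unfolding cocycle_Suc_left comp_apply by (rule isometry_eval_measurable2[OF g])
qed simp

lemma T_pow [measurable]: "T ^^ n \<in> M \<rightarrow>\<^sub>M M"
  by (induction n) (auto simp: id_def)

lemma T_pow_space: "\<omega> \<in> space M \<Longrightarrow> (T ^^ n) \<omega> \<in> space M"
  by (rule measurable_space[OF T_pow])

lemma distr_T_pow: "distr M M (T ^^ n) = M"
proof (induction n)
  case (Suc n)
  have "distr M M (T \<circ> T ^^ n) = distr (distr M M (T ^^ n)) M T"
    by (rule distr_distr[symmetric]) (rule T T_pow)+
  then show ?case by (simp only: funpow.simps Suc T_preserves)
qed (simp add: id_def)

lemma AE_orbit:
  assumes "AE \<omega> in M. P \<omega>" shows "AE \<omega> in M. \<forall>n. P ((T ^^ n) \<omega>)"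
  unfolding AE_all_countable
proof
  fix n show "AE \<omega> in M. P ((T ^^ n) \<omega>)"
    by (rule AE_distrD[OF T_pow]) (simp only: distr_T_pow assms)
qed

lemma integral_T:
  fixes f :: "'w \<Rightarrow> real"
  assumes "f \<in> borel_measurable M"
  shows "(\<integral>\<omega>. f ((T ^^ n) \<omega>) \<partial>M) = (\<integral>\<omega>. f \<omega> \<partial>M)"
  using integral_distr[OF T_pow assms, of n] by (simp add: distr_T_pow)

lemma integrable_T:
  fixes f :: "'w \<Rightarrow> real"
  assumes "integrable M f"
  shows "integrable M (\<lambda>\<omega>. f ((T ^^ n) \<omega>))"
  using integrable_distr[OF T_pow, of n f] assms by (simp add: distr_T_pow)

lemma cocycle_isometry:
  assumes "isom_measurable g" "\<omega> \<in> space M"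
  shows "cocycle T g n \<omega> \<in> isometries"
  using isom_measurable_isometry[OF assms(1) T_pow_space[OF assms(2)]] by (rule cocycle_isometries)

text \<open>The bound is essential because one \<open>R\<close> must serve all cocycles near a given
  one, and closeness of representatives controls them only almost everywhere.\<close>

definition ess_bounded :: "('w \<Rightarrow> 'x \<Rightarrow> 'x) \<Rightarrow> real \<Rightarrow> bool" where
  "ess_bounded g R \<longleftrightarrow> isom_measurable g \<and> (AE \<omega> in M. dist (g \<omega> x0) x0 \<le> R)"

text \<open>The quantities f_n, F_n and p_n of the overview are \<open>disp g n\<close>,
  \<open>mean_disp g n\<close> and \<open>exp_mean g n\<close>.\<close>

definition disp :: "('w \<Rightarrow> 'x \<Rightarrow> 'x) \<Rightarrow> nat \<Rightarrow> 'w \<Rightarrow> real" where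
  "disp g n \<omega> = dist (cocycle T g n \<omega> x0) x0"

definition mean_disp :: "('w \<Rightarrow> 'x \<Rightarrow> 'x) \<Rightarrow> nat \<Rightarrow> real" where
  "mean_disp g n = (\<integral>\<omega>. disp g n \<omega> \<partial>M)"

definition exp_mean :: "('w \<Rightarrow> 'x \<Rightarrow> 'x) \<Rightarrow> nat \<Rightarrow> real" where
  "exp_mean g n = (\<integral>\<omega>. b powr - disp g n \<omega> \<partial>M)"

section \<open>Displacement, drift and the variation of increments\<close>

lemma ess_boundedD: "ess_bounded g R \<Longrightarrow> isom_measurable g"
  by (simp add: ess_bounded_def)

lemma ess_bounded_orbit:
  assumes "ess_bounded g R"
  shows "AE \<omega> in M. \<forall>n. g ((T ^^ n) \<omega>) \<in> isometries \<and> dist (g ((T ^^ n) \<omega>) x0) x0 \<le> R"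
proof (rule AE_orbit)
  show "AE \<omega> in M. g \<omega> \<in> isometries \<and> dist (g \<omega> x0) x0 \<le> R"
    using assms isom_measurable_isometry by (auto simp: ess_bounded_def)
qed

lemma ess_bounded_nonneg:
  assumes "ess_bounded g R" shows "0 \<le> R"
proof -
  have "AE \<omega> in M. 0 \<le> R"
    using assms[unfolded ess_bounded_def, THEN conjunct2]
    by eventually_elim (rule order_trans[OF zero_le_dist])
  then show ?thesis by simp
qed

lemma ess_bounded_mono: "ess_bounded g R \<Longrightarrow> R \<le> S \<Longrightarrow> ess_bounded g S"
  unfolding ess_bounded_def by (auto elim: AE_mp)

lemma disp_nonneg: "0 \<le> disp g n \<omega>"
  by (simp add: disp_def)

lemma disp_measurable: "isom_measurable g \<Longrightarrow> disp g n \<in> borel_measurable M"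
  unfolding disp_def[abs_def] by (rule borel_measurable_dist_separable[OF sep cocycle_measurable]) auto

lemma disp_add_le:
  assumes "isom_measurable g" "\<omega> \<in> space M"
  shows "disp g (m + n) \<omega> \<le> disp g m \<omega> + disp g n ((T ^^ m) \<omega>)"
  using isometriesD(2)[OF cocycle_isometry[OF assms, of m], of "cocycle T g n ((T ^^ m) \<omega>) x0" x0]
    dist_triangle[of "cocycle T g (m + n) \<omega> x0" x0 "cocycle T g m \<omega> x0"]
  by (simp add: disp_def cocycle_add)

lemma cocycle_dist_le:
  assumes "\<And>k. g ((T ^^ k) \<omega>) \<in> isometries" "\<And>k. dist (g ((T ^^ k) \<omega>) x0) x0 \<le> R"
  shows "dist (cocycle T g n \<omega> y) x0 \<le> dist y x0 + real n * R"
proof (induction n arbitrary: y)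
  case (Suc n)
  have "dist (g ((T ^^ n) \<omega>) y) x0 \<le> dist y x0 + R"
    using dist_triangle[of "g ((T ^^ n) \<omega>) y" x0 "g ((T ^^ n) \<omega>) x0"]
      isometriesD(2)[OF assms(1)[of n], of y x0] assms(2)[of n] by simp
  then show ?case using Suc[of "g ((T ^^ n) \<omega>) y"] by (simp add: algebra_simps)
qed simp

lemma disp_bounded:
  assumes "ess_bounded g R" shows "AE \<omega> in M. disp g n \<omega> \<le> real n * R"
  using ess_bounded_orbit[OF assms]
  by eventually_elim (use cocycle_dist_le[of g _ R n x0] in \<open>auto simp: disp_def\<close>)

lemma disp_integrable:
  assumes "ess_bounded g R" shows "integrable M (disp g n)"
  using disp_bounded[OF assms, of n] disp_measurable[OF ess_boundedD[OF assms], of n]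
  by (intro integrable_const_bound[of _ "real n * R"]) (auto simp: disp_nonneg)

lemma powr_disp_le_1: "b powr - disp g n \<omega> \<le> 1"
  using powr_mono[of "- disp g n \<omega>" 0 b] b disp_nonneg[of g n \<omega>] by simp

lemma powr_disp_integrable:
  assumes "isom_measurable g" shows "integrable M (\<lambda>\<omega>. b powr - disp g n \<omega>)"
  using disp_measurable[OF assms, of n] powr_disp_le_1
  by (intro integrable_const_bound[of _ 1]) auto

lemma mean_disp_add:
  assumes "ess_bounded g R"
  shows "mean_disp g (m + n) \<le> mean_disp g m + mean_disp g n"
proof -
  have "mean_disp g (m + n) \<le> (\<integral>\<omega>. disp g m \<omega> + disp g n ((T ^^ m) \<omega>) \<partial>M)"
    unfolding mean_disp_def
    using disp_integrable[OF assms] disp_add_le[OF ess_boundedD[OF assms]]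
    by (intro integral_mono Bochner_Integration.integrable_add integrable_T) auto
  also have "\<dots> = mean_disp g m + mean_disp g n"
    unfolding mean_disp_def using disp_integrable[OF assms] integrable_T[OF disp_integrable[OF assms]]
      integral_T[OF disp_measurable[OF ess_boundedD[OF assms]]]
    by (simp add: Bochner_Integration.integral_add)
  finally show ?thesis .
qed

lemma finite_drift_eq: "finite_drift M T x0 n g = mean_disp g n / real n"
  by (simp add: finite_drift_def mean_disp_def disp_def)

lemma
  assumes "ess_bounded g R"
  shows drift_limit: "(\<lambda>n. mean_disp g n / real n) \<longlonglongrightarrow> drift M T x0 g"
    and drift_le_mean_disp: "real n * drift M T x0 g \<le> mean_disp g n"
    and drift_nonneg: "0 \<le> drift M T x0 g"
proof -
  have "0 \<le> mean_disp g n" for n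
    unfolding mean_disp_def by (simp add: disp_nonneg)
  then obtain L where L: "(\<lambda>n. mean_disp g n / real n) \<longlonglongrightarrow> L"
    "\<And>n. real n * L \<le> mean_disp g n" "0 \<le> L"
    using subadditive_limit[of "mean_disp g"] mean_disp_add[OF assms] by blast
  then have "drift M T x0 g = L"
    unfolding drift_def finite_drift_eq by (simp add: limI)
  then show "(\<lambda>n. mean_disp g n / real n) \<longlonglongrightarrow> drift M T x0 g"
    "real n * drift M T x0 g \<le> mean_disp g n" "0 \<le> drift M T x0 g"
    using L by auto
qed

text \<open>Since g^n is an isometry, consecutive orbit points are at distance at most
  \<open>R\<close>, so their product is at least the displacement minus \<open>R\<close>. The bound
  serves both the increments of the mean and the convergence of the orbit.\<close>

lemma vis_cocycle_Suc_le:
  assumes "\<And>k. g ((T ^^ k) \<omega>) \<in> isometries" "\<And>k. dist (g ((T ^^ k) \<omega>) x0) x0 \<le> R"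
  shows "vis (cocycle T g n \<omega> x0) (cocycle T g (Suc n) \<omega> x0) \<le> b powr R * b powr - disp g n \<omega>"
proof -
  have "cocycle T g n \<omega> \<in> isometries"
    using assms(1) by (rule cocycle_isometries)
  then have "dist (cocycle T g n \<omega> x0) (cocycle T g (Suc n) \<omega> x0) \<le> R"
    using assms(2)[of n] by (simp add: isometriesD(2) dist_commute)
  then have "vis (cocycle T g n \<omega> x0) (cocycle T g (Suc n) \<omega> x0) \<le> b powr (R + - disp g n \<omega>)"
    using gromov_prod_ge[of "cocycle T g n \<omega> x0" x0 "cocycle T g (Suc n) \<omega> x0"] b
    unfolding disp_def by (intro powr_mono) auto
  then show ?thesis unfolding powr_add .
qed

text \<open>With \<open>a = g(\<omega>)\<^sup>-\<^sup>1 x0\<close> and \<open>y_n = g\<^sup>n(T \<omega>) x0\<close>, the increment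
  \<open>disp g (n + 1) \<omega> - disp g n (T \<omega>)\<close> equals \<open>d(a, x0) - 2 \<langle>a, y_n\<rangle>\<close>. Since \<open>\<langle>a, y_n\<rangle> \<le> R\<close>,
  strong hyperbolicity bounds its variation in \<open>n\<close> by the visual distance of \<open>y_n\<close> and \<open>y_(n + 1)\<close>.\<close>

lemma disp_increment_variation:
  assumes "\<omega> \<in> space M" "\<And>k. g ((T ^^ k) \<omega>) \<in> isometries" "\<And>k. dist (g ((T ^^ k) \<omega>) x0) x0 \<le> R"
  shows "\<bar>(disp g (Suc n) \<omega> - disp g n (T \<omega>)) - (disp g (Suc (Suc n)) \<omega> - disp g (Suc n) (T \<omega>))\<bar>
    \<le> 2 * b powr (2 * R) / ln b * b powr - disp g n (T \<omega>)"
proof -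
  define a where "a = inv (g \<omega>) x0"
  define y where "y n = cocycle T g n (T \<omega>) x0" for n
  have g: "g \<omega> \<in> isometries" "dist (g \<omega> x0) x0 \<le> R" using assms(2,3)[of 0] by auto
  have g': "g ((T ^^ k) (T \<omega>)) \<in> isometries" "dist (g ((T ^^ k) (T \<omega>)) x0) x0 \<le> R" for k
    using assms(2,3)[of "Suc k"] by (auto simp: funpow_swap1)
  have a: "dist a x0 \<le> R"
    using isometriesD(2)[OF g(1), of a x0] isometriesD(3)[OF g(1)] g(2) by (simp add: a_def dist_commute)
  have dy: "disp g n (T \<omega>) = dist (y n) x0" for n
    by (simp add: disp_def y_def)
  have "disp g (Suc n) \<omega> = dist (y n) a" for n
    using isometriesD(2)[OF g(1), of "y n" a] isometriesD(3)[OF g(1)]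
    unfolding disp_def cocycle_Suc_left by (simp add: a_def y_def)
  then have incr: "disp g (Suc n) \<omega> - disp g n (T \<omega>) = dist a x0 - 2 * gromov_prod x0 a (y n)" for n
    unfolding dy by (simp add: gromov_prod_def dist_commute field_simps)
  have "\<bar>gromov_prod x0 a (y n) - gromov_prod x0 a (y (Suc n))\<bar>
      \<le> b powr R / ln b * \<bar>vis a (y n) - vis a (y (Suc n))\<bar>"
    using gromov_prod_le_dist[of x0 a] a by (intro diff_le_powr_neg_diff b) (meson order_trans)+
  also have "\<dots> \<le> b powr R / ln b * vis (y n) (y (Suc n))"
    using vis_triangle[of a "y n" "y (Suc n)"] vis_triangle[of a "y (Suc n)" "y n"] b
      vis_commute[of "y n" "y (Suc n)"]
    by (intro mult_left_mono) auto
  also have "\<dots> \<le> b powr R / ln b * (b powr R * b powr - disp g n (T \<omega>))"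
    unfolding y_def using b by (intro mult_left_mono vis_cocycle_Suc_le g') auto
  also have "\<dots> = b powr (2 * R) / ln b * b powr - disp g n (T \<omega>)"
    by (simp add: powr_add[symmetric])
  finally show ?thesis unfolding incr by (simp add: abs_if split: if_splits)
qed

text \<open>Invariance of the measure removes the shift: f_n composed with \<open>T\<close> has mean
  F_n, and the pointwise error has mean p_n up to the constant.\<close>

lemma mean_disp_increment_variation:
  assumes "ess_bounded g R"
  shows "\<bar>(mean_disp g (Suc n) - mean_disp g n) - (mean_disp g (Suc (Suc n)) - mean_disp g (Suc n))\<bar>
    \<le> 2 * b powr (2 * R) / ln b * exp_mean g n"
proof -
  note int = disp_integrable[OF assms] integrable_T[OF disp_integrable[OF assms], of _ 1, simplified]
  note pint = powr_disp_integrable[OF ess_boundedD[OF assms], of n]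
  have intT: "(\<integral>\<omega>. disp g k (T \<omega>) \<partial>M) = (\<integral>\<omega>. disp g k \<omega> \<partial>M)" for k
    using integral_T[OF disp_measurable[OF ess_boundedD[OF assms], of k], of 1] by simp
  let ?D = "\<lambda>\<omega>. (disp g (Suc n) \<omega> - disp g n (T \<omega>)) - (disp g (Suc (Suc n)) \<omega> - disp g (Suc n) (T \<omega>))"
  have "\<bar>(mean_disp g (Suc n) - mean_disp g n) - (mean_disp g (Suc (Suc n)) - mean_disp g (Suc n))\<bar>
      = \<bar>\<integral>\<omega>. ?D \<omega> \<partial>M\<bar>"
    using int intT by (simp add: mean_disp_def)
  also have "\<dots> \<le> (\<integral>\<omega>. \<bar>?D \<omega>\<bar> \<partial>M)" by (rule integral_abs_bound)
  also have "\<dots> \<le> (\<integral>\<omega>. 2 * b powr (2 * R) / ln b * b powr - disp g n (T \<omega>) \<partial>M)"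
  proof (rule integral_mono_AE)
    show "AE \<omega> in M. \<bar>?D \<omega>\<bar> \<le> 2 * b powr (2 * R) / ln b * b powr - disp g n (T \<omega>)"
      using ess_bounded_orbit[OF assms] AE_space[of M]
    proof eventually_elim
      case (elim \<omega>)
      show ?case
        by (rule disp_increment_variation) (use elim in blast)+
    qed
    show "integrable M (\<lambda>\<omega>. 2 * b powr (2 * R) / ln b * b powr - disp g n (T \<omega>))"
      using integrable_T[OF pint, of 1] by (intro Bochner_Integration.integrable_mult_right) simp
  qed (use int in simp)
  also have "\<dots> = 2 * b powr (2 * R) / ln b * exp_mean g n"
    using integral_T[of "\<lambda>\<omega>. b powr - disp g n \<omega>" 1] borel_measurable_integrable[OF pint]
    by (simp add: exp_mean_def)
  finally show ?thesis .
qed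

text \<open>Outside the deviation set the displacement is at least n l - n l / 2 and the first term
  bounds the integrand; on the deviation set the integrand is at most 1 and the probability is the
  bound.\<close>

lemma exp_mean_le:
  assumes g: "isom_measurable g" and n: "0 < n" and lam: "real n * l \<le> mean_disp g n"
    and dev: "measure M {\<omega>\<in>space M. \<bar>1 / real n * disp g n \<omega> - mean_disp g n / real n\<bar> > l / 2} < p"
  shows "exp_mean g n \<le> b powr - (real n * l / 2) + p"
proof -
  let ?E = "{\<omega>\<in>space M. \<bar>1 / real n * disp g n \<omega> - mean_disp g n / real n\<bar> > l / 2}"
  have E: "?E \<in> sets M" using disp_measurable[OF g, of n] by measurable
  have "exp_mean g n \<le> (\<integral>\<omega>. b powr - (real n * l / 2) + indicator ?E \<omega> \<partial>M)"
    unfolding exp_mean_def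
  proof (rule integral_mono)
    show "integrable M (\<lambda>\<omega>. b powr - (real n * l / 2) + indicat_real ?E \<omega>)"
      using E by (intro Bochner_Integration.integrable_add) (auto simp: emeasure_eq_measure)
    fix \<omega> assume \<omega>: "\<omega> \<in> space M"
    show "b powr - disp g n \<omega> \<le> b powr - (real n * l / 2) + indicat_real ?E \<omega>"
    proof (cases "\<omega> \<in> ?E")
      case True
      then show ?thesis using powr_disp_le_1[of g n \<omega>] by (simp add: add_increasing)
    next
      case False
      then have "\<bar>disp g n \<omega> / real n - mean_disp g n / real n\<bar> \<le> l / 2" using \<omega> by simp
      then have "mean_disp g n / real n - l / 2 \<le> disp g n \<omega> / real n" by linarith
      moreover have "l \<le> mean_disp g n / real n" using lam n by (simp add: field_simps)
      ultimately have "l / 2 \<le> disp g n \<omega> / real n" by linarith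
      then have "real n * l / 2 \<le> disp g n \<omega>" using n by (simp add: field_simps)
      then show ?thesis using False b by (auto intro!: powr_mono)
    qed
  qed (rule powr_disp_integrable[OF g])
  also have "\<dots> = b powr - (real n * l / 2) + measure M ?E"
    using E by (subst Bochner_Integration.integral_add) (auto simp: emeasure_eq_measure prob_space)
  finally show ?thesis using dev by simp
qed

text \<open>The innermost factor is exchanged first. The remaining product of \<open>g1\<close> is
  an isometry, so this costs just \<open>dist (g1 y) (g2 y)\<close> at time \<open>n\<close>; the
  induction hypothesis is then applied at the moved point, which is why \<open>y\<close> is
  arbitrary. Each move goes at most \<open>R\<close> further out, so every exchange takes place
  within radius \<open>dist y x0 + real n * R\<close>.\<close>

lemma cocycle_lipschitz:
  assumes "\<And>k. g1 ((T ^^ k) \<omega>) \<in> isometries" "\<And>k. dist (g1 ((T ^^ k) \<omega>) x0) x0 \<le> R"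
    and "\<And>k. g2 ((T ^^ k) \<omega>) \<in> isometries" "\<And>k. dist (g2 ((T ^^ k) \<omega>) x0) x0 \<le> R"
    and "\<And>k. isom_dist x0 b (g1 ((T ^^ k) \<omega>)) (g2 ((T ^^ k) \<omega>)) \<le> t"
  shows "dist (cocycle T g1 n \<omega> y) (cocycle T g2 n \<omega> y)
    \<le> real n * (2 / ln b * b powr (2 * (dist y x0 + real n * R)) * t)"
proof (induction n arbitrary: y)
  case (Suc n)
  let ?S = "(T ^^ n) \<omega>"
  have R: "0 \<le> R" using assms(2)[of 0] zero_le_dist order_trans by blast
  have t: "0 \<le> t" using assms(5)[of 0] isom_dist_nonneg order_trans by blast
  have isoc: "cocycle T g1 n \<omega> \<in> isometries"
    using assms(1) by (rule cocycle_isometries)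
  have y: "dist (g1 ?S y) x0 \<le> dist y x0 + R" "dist (g2 ?S y) x0 \<le> dist y x0 + R"
    using dist_triangle[of "g1 ?S y" x0 "g1 ?S x0"] dist_triangle[of "g2 ?S y" x0 "g2 ?S x0"]
      isometriesD(2)[OF assms(1)[of n], of y x0] isometriesD(2)[OF assms(3)[of n], of y x0]
      assms(2)[of n] assms(4)[of n] by simp_all
  have mono: "2 / ln b * b powr (2 * u) * t \<le> 2 / ln b * b powr (2 * v) * t" if "u \<le> v" for u v
    using that b t by (intro mult_right_mono mult_left_mono powr_mono) auto
  let ?c = "2 / ln b * b powr (2 * (dist y x0 + real (Suc n) * R)) * t"
  have "dist (cocycle T g1 n \<omega> (g1 ?S y)) (cocycle T g1 n \<omega> (g2 ?S y)) = dist (g1 ?S y) (g2 ?S y)"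
    by (rule isometriesD(2)[OF isoc])
  also have "\<dots> \<le> 2 / ln b * b powr (2 * (dist y x0 + R)) * isom_dist x0 b (g1 ?S) (g2 ?S)"
    using y by (rule dist_le_isom_dist)
  also have "\<dots> \<le> 2 / ln b * b powr (2 * (dist y x0 + R)) * t"
    using assms(5)[of n] b by (intro mult_left_mono) auto
  also have "\<dots> \<le> ?c" using R by (intro mono) (simp add: algebra_simps)
  finally have 1: "dist (cocycle T g1 n \<omega> (g1 ?S y)) (cocycle T g1 n \<omega> (g2 ?S y)) \<le> ?c" .
  have "dist (cocycle T g1 n \<omega> (g2 ?S y)) (cocycle T g2 n \<omega> (g2 ?S y))
      \<le> real n * (2 / ln b * b powr (2 * (dist (g2 ?S y) x0 + real n * R)) * t)"
    by (rule Suc)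
  also have "\<dots> \<le> real n * ?c"
    using y by (intro mult_left_mono mono) (simp_all add: algebra_simps)
  finally have "dist (cocycle T g1 n \<omega> (g1 ?S y)) (cocycle T g2 n \<omega> (g2 ?S y)) \<le> ?c + real n * ?c"
    using 1 dist_triangle[of "cocycle T g1 n \<omega> (g1 ?S y)" "cocycle T g2 n \<omega> (g2 ?S y)" "cocycle T g1 n \<omega> (g2 ?S y)"]
    by linarith
  also have "?c + real n * ?c = real (Suc n) * ?c" by (simp only: of_nat_Suc distrib_right mult_1)
  finally show ?case by simp
qed simp

text \<open>The base B of the overview: \<open>b powr (2 * R)\<close> is the price per time step of
  comparing isometries ever further out, and the factor 2 absorbs the number of steps through n
  \<le> 2^n.\<close>

definition growth :: "real \<Rightarrow> real" where
  "growth R = 2 * b powr (2 * R)"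

lemma growth_ge_2: "0 \<le> R \<Longrightarrow> 2 \<le> growth R"
  using powr_mono[of 0 "2 * R" b] b by (simp add: growth_def)

lemma AE_dist_cocycle_le:
  assumes g1: "ess_bounded g1 R" and g2: "ess_bounded g2 R"
    and t: "AE \<omega> in M. isom_dist x0 b (g1 \<omega>) (g2 \<omega>) \<le> t"
  shows "AE \<omega> in M. dist (cocycle T g1 n \<omega> x0) (cocycle T g2 n \<omega> x0) \<le> 2 / ln b * growth R ^ n * t"
  using ess_bounded_orbit[OF g1] ess_bounded_orbit[OF g2] AE_orbit[OF t]
proof eventually_elim
  case (elim \<omega>)
  have t: "0 \<le> t" using elim isom_dist_nonneg order_trans by blast
  have "real n \<le> 2 ^ n" by (rule of_nat_less_two_power[THEN less_imp_le])
  moreover have "b powr (2 * (real n * R)) = (b powr (2 * R)) ^ n"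
    using b by (simp add: powr_realpow[symmetric] powr_powr mult_ac)
  ultimately have "real n * b powr (2 * (real n * R)) \<le> growth R ^ n"
    using b by (simp add: growth_def power_mult_distrib)
  then have "2 / ln b * (real n * b powr (2 * (real n * R))) * t \<le> 2 / ln b * growth R ^ n * t"
    using b t by (intro mult_right_mono mult_left_mono) auto
  moreover have "dist (cocycle T g1 n \<omega> x0) (cocycle T g2 n \<omega> x0)
    \<le> real n * (2 / ln b * b powr (2 * (dist x0 x0 + real n * R)) * t)"
    using elim by (intro cocycle_lipschitz) auto
  ultimately show ?case by (simp add: mult_ac)
qed

lemma mean_disp_lipschitz:
  assumes g1: "ess_bounded g1 R" and g2: "ess_bounded g2 R"
    and t: "AE \<omega> in M. isom_dist x0 b (g1 \<omega>) (g2 \<omega>) \<le> t"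
  shows "\<bar>mean_disp g1 n - mean_disp g2 n\<bar> \<le> 2 / ln b * growth R ^ n * t"
proof -
  have "\<bar>mean_disp g1 n - mean_disp g2 n\<bar> = \<bar>\<integral>\<omega>. disp g1 n \<omega> - disp g2 n \<omega> \<partial>M\<bar>"
    unfolding mean_disp_def using disp_integrable[OF g1] disp_integrable[OF g2] by simp
  also have "\<dots> \<le> (\<integral>\<omega>. \<bar>disp g1 n \<omega> - disp g2 n \<omega>\<bar> \<partial>M)" by (rule integral_abs_bound)
  also have "\<dots> \<le> (\<integral>\<omega>. 2 / ln b * growth R ^ n * t \<partial>M)"
  proof (rule integral_mono_AE)
    have le: "\<bar>disp g1 n \<omega> - disp g2 n \<omega>\<bar> \<le> dist (cocycle T g1 n \<omega> x0) (cocycle T g2 n \<omega> x0)" for \<omega>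
      using dist_triangle[of "cocycle T g1 n \<omega> x0" x0 "cocycle T g2 n \<omega> x0"]
        dist_triangle[of "cocycle T g2 n \<omega> x0" x0 "cocycle T g1 n \<omega> x0"]
      by (simp add: disp_def dist_commute abs_le_iff)
    show "AE \<omega> in M. \<bar>disp g1 n \<omega> - disp g2 n \<omega>\<bar> \<le> 2 / ln b * growth R ^ n * t"
      using AE_dist_cocycle_le[OF assms, of n] by eventually_elim (rule order_trans[OF le])
  qed (use disp_integrable[OF g1] disp_integrable[OF g2] in auto)
  finally show ?thesis by (simp add: prob_space)
qed

end

section \<open>Exponential convergence to the drift and to the hitting point\<close>

lemma AE_summable_of_summable_integral:
  fixes f :: "nat \<Rightarrow> 'a \<Rightarrow> real"
  assumes f: "\<And>i. integrable M (f i)" "\<And>i x. 0 \<le> f i x" and sum: "summable (\<lambda>i. \<integral>x. f i x \<partial>M)"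
  shows "AE x in M. summable (\<lambda>i. f i x)"
proof -
  have [measurable]: "f i \<in> borel_measurable M" for i
    using f(1) by (rule borel_measurable_integrable)
  have "(\<integral>\<^sup>+x. (\<Sum>i. ennreal (f i x)) \<partial>M) = (\<Sum>i. \<integral>\<^sup>+x. ennreal (f i x) \<partial>M)"
    by (rule nn_integral_suminf) measurable
  also have "\<dots> = (\<Sum>i. ennreal (\<integral>x. f i x \<partial>M))"
    using f by (simp add: nn_integral_eq_integral)
  also have "\<dots> = ennreal (\<Sum>i. \<integral>x. f i x \<partial>M)"
    using f sum by (intro suminf_ennreal2) auto
  finally have "(\<integral>\<^sup>+x. (\<Sum>i. ennreal (f i x)) \<partial>M) \<noteq> \<infinity>" by simp
  then have "AE x in M. (\<Sum>i. ennreal (f i x)) \<noteq> \<infinity>"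
    by (intro nn_integral_PInf_AE) measurable
  then show ?thesis
    by eventually_elim (rule summable_suminf_not_top, use f in auto)
qed

text \<open>For a non-integrable \<open>f\<close> the Bochner integral is 0 by convention, and
  \<open>g\<close> is nonnegative almost everywhere. The distance of two hitting points can thus be
  bounded without examining its integrability.\<close>

lemma integral_le_of_AE_le:
  fixes f g :: "'a \<Rightarrow> real"
  assumes "integrable M g" "AE x in M. f x \<le> g x" "AE x in M. 0 \<le> f x"
  shows "(\<integral>x. f x \<partial>M) \<le> (\<integral>x. g x \<partial>M)"
proof (cases "integrable M f")
  case True
  then show ?thesis using assms by (intro integral_mono_AE) auto
next
  case False
  have "AE x in M. 0 \<le> g x" using assms(2,3) by eventually_elim simp
  then show ?thesis using False by (simp add: not_integrable_integral_eq integral_nonneg_AE)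
qed

section \<open>Convergence of sequences with summable visual steps\<close>

context strongly_hyperbolic_space
begin

text \<open>The diagonal has \<open>vis x x > 0\<close>, which the first term of the tail absorbs.\<close>

lemma vis_le_tail:
  assumes s: "summable s" "\<And>k. 0 \<le> s k" and C: "1 \<le> C"
    and step: "\<And>k. vis (x k) (x (Suc k)) \<le> C * s k" and diag: "\<And>k. vis (x k) (x k) \<le> s k"
    and mn: "m \<le> n"
  shows "vis (x m) (x n) \<le> C * (\<Sum>k. s (k + m))"
proof -
  have sm: "summable (\<lambda>k. s (k + m))" using s(1) by (rule summable_ignore_initial_segment)
  have partial: "C * (\<Sum>k<j. s (k + m)) \<le> C * (\<Sum>k. s (k + m))" for j
    using sm s(2) C by (intro mult_left_mono sum_le_suminf) auto
  show ?thesis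
  proof (cases "m = n")
    case True
    have "vis (x m) (x n) \<le> s m" using True diag by simp
    also have "\<dots> \<le> C * s m" using C s(2)[of m] by (simp add: mult_le_cancel_right1)
    also have "\<dots> = C * (\<Sum>k<1. s (k + m))" by simp
    also note partial
    finally show ?thesis .
  next
    case False
    have "vis (x m) (x (m + Suc j)) \<le> C * (\<Sum>k<Suc j. s (k + m))" for j
    proof (induction j)
      case 0
      show ?case using step[of m] by simp
    next
      case (Suc j)
      have "vis (x m) (x (m + Suc (Suc j))) \<le> vis (x m) (x (m + Suc j)) + vis (x (m + Suc j)) (x (Suc (m + Suc j)))"
        using vis_triangle[of "x m" "x (m + Suc (Suc j))" "x (m + Suc j)"] by simp
      also have "\<dots> \<le> C * (\<Sum>k<Suc j. s (k + m)) + C * s (m + Suc j)"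
        by (intro add_mono Suc step)
      also have "\<dots> = C * (\<Sum>k<Suc (Suc j). s (k + m))"
        by (simp add: distrib_left add.commute)
      finally show ?case .
    qed
    from this[of "n - m - 1"] have "vis (x m) (x n) \<le> C * (\<Sum>k<Suc (n - m - 1). s (k + m))"
      using False mn by simp
    also note partial
    finally show ?thesis .
  qed
qed

lemma summable_steps_converge:
  assumes s: "summable s" "\<And>k. 0 \<le> s k" and C: "1 \<le> C"
    and step: "\<And>k. vis (x k) (x (Suc k)) \<le> C * s k" and diag: "\<And>k. vis (x k) (x k) \<le> s k"
  shows "gromov_seq x0 x" and "rho x0 b (Inner (x m)) (limit_pt x) \<le> C * (\<Sum>k. s (k + m))"
proof -
  note tail = vis_le_tail[where x = x, OF assms]
  show G: "gromov_seq x0 x"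
    unfolding gromov_seq_iff
  proof (intro allI impI)
    fix e :: real assume "0 < e"
    then have "0 < e / C" using C by simp
    then obtain N where N: "\<And>n. N \<le> n \<Longrightarrow> norm (\<Sum>k. s (k + n)) < e / C"
      using suminf_exist_split[OF _ s(1)] by blast
    have less: "vis (x m) (x n) < e" if "N \<le> m" "m \<le> n" for m n
    proof -
      have "(\<Sum>k. s (k + m)) < e / C" using N[OF that(1)] by simp
      then have "C * (\<Sum>k. s (k + m)) < e" using C by (simp add: pos_less_divide_eq mult.commute)
      then show ?thesis using tail[OF that(2)] by linarith
    qed
    show "\<exists>N. \<forall>m\<ge>N. \<forall>n\<ge>N. vis (x m) (x n) < e"
    proof (intro exI[of _ N] allI impI)
      fix m n assume "N \<le> m" "N \<le> n"
      then show "vis (x m) (x n) < e"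
        using less[of m n] less[of n m] vis_commute[of "x m" "x n"] by (cases "m \<le> n") auto
    qed
  qed
  show "rho x0 b (Inner (x m)) (limit_pt x) \<le> C * (\<Sum>k. s (k + m))"
  proof (rule rho_Inner_limit_pt_le[OF G])
    show "\<forall>\<^sub>F n in sequentially. vis (x m) (x n) \<le> C * (\<Sum>k. s (k + m))"
      using eventually_ge_at_top[of m] by eventually_elim (rule tail)
    show "0 \<le> C * (\<Sum>k. s (k + m))"
      using C s summable_ignore_initial_segment[OF s(1)] by (intro mult_nonneg_nonneg suminf_nonneg) auto
  qed
qed

lemma open_rho_less: "open {y. rho x0 b (Inner y) \<eta> < c}"
  unfolding open_dist
proof
  fix y assume "y \<in> {y. rho x0 b (Inner y) \<eta> < c}"
  then have y: "rho x0 b (Inner y) \<eta> < c" by simp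
  have "((\<lambda>r. rho x0 b (Inner y) \<eta> + ln b * r) \<longlongrightarrow> rho x0 b (Inner y) \<eta> + ln b * 0) (at_right 0)"
    by (intro tendsto_intros)
  then have "\<forall>\<^sub>F r in at_right 0. rho x0 b (Inner y) \<eta> + ln b * r < c"
    using y by (intro order_tendstoD) auto
  then obtain e where e: "0 < e" "\<And>r. 0 < r \<Longrightarrow> r < e \<Longrightarrow> rho x0 b (Inner y) \<eta> + ln b * r < c"
    unfolding eventually_at_right_field by auto
  show "\<exists>e>0. \<forall>z. dist z y < e \<longrightarrow> z \<in> {y. rho x0 b (Inner y) \<eta> < c}"
  proof (intro exI[of _ e] conjI allI impI)
    fix z assume "dist z y < e"
    then show "z \<in> {y. rho x0 b (Inner y) \<eta> < c}"
      using rho_lipschitz[OF b, of x0 z \<eta> y] e(2)[of "dist z y"] y by (cases "z = y") auto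
  qed (rule e(1))
qed

lemma hitting_point_limit_pt:
  assumes "gromov_seq x0 (\<lambda>n. cocycle T g n \<omega> x0)"
  shows "hitting_point T x0 g \<omega> = limit_pt (\<lambda>n. cocycle T g n \<omega> x0)"
  using assms by (simp add: hitting_point_def)

text \<open>Within distance 1 the product is at least \<open>dist y x0 - 1\<close>; beyond it the
  distance exceeds every visual distance. A first term of this kind is unavoidable because of the
  positive self-distance, but along an orbit its mean is b p_n, hence exponentially small.\<close>

lemma vis_le_powr_plus_dist: "vis y z \<le> b * b powr - dist y x0 + dist y z"
proof (cases "dist y z \<le> 1")
  case True
  then have "vis y z \<le> b powr (1 + - dist y x0)"
    using gromov_prod_ge[of y x0 z] b by (intro powr_mono) auto
  then have "vis y z \<le> b * b powr - dist y x0" using b by (simp add: powr_add powr_diff powr_minus_divide)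
  then show ?thesis by (simp add: add_increasing2)
next
  case False
  have "vis y z \<le> 1" using rho_le_1[OF b, of x0 "Inner y" "Inner z"] by (simp add: rho_Inner)
  then show ?thesis using False b by (simp add: add_increasing)
qed

end

section \<open>Uniform exponential estimates near a cocycle of positive drift\<close>

context cocycle_system
begin

text \<open>The estimate at one fixed deviation, with its constants explicit so that a whole
  neighbourhood can share them.\<close>

definition deviation_bound :: "('w \<Rightarrow> 'x \<Rightarrow> 'x) \<Rightarrow> real \<Rightarrow> real \<Rightarrow> nat \<Rightarrow> bool" where
  "deviation_bound g e c N \<longleftrightarrow> (\<forall>n\<ge>N.
     measure M {\<omega>\<in>space M. \<bar>(1 / real n) * dist (cocycle T g n \<omega> x0) x0 - finite_drift M T x0 n g\<bar> > e}
       < b powr (- c * e\<^sup>2 * real n))"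

text \<open>The slower of the two decays in \<open>exp_mean_le\<close>: l / 2 comes from the typical
  points, c (l / 2)^2 from the probability of a deviation by l / 2.\<close>

definition rate :: "real \<Rightarrow> real \<Rightarrow> real" where
  "rate l c = b powr - min (l / 2) (c * (l / 2)\<^sup>2)"

lemma rate_bounds: "0 < l \<Longrightarrow> 0 < c \<Longrightarrow> 0 < rate l c \<and> rate l c < 1"
  using b powr_less_mono[of "- min (l / 2) (c * (l / 2)\<^sup>2)" 0 b] by (simp add: rate_def)

lemma exp_mean_decay:
  assumes g: "isom_measurable g" and dev: "deviation_bound g (l / 2) c N" and n: "N \<le> n" "0 < n"
    and lam: "real n * l \<le> mean_disp g n"
  shows "exp_mean g n \<le> 2 * rate l c ^ n"
proof -
  have rate: "rate l c ^ n = b powr (- min (l / 2) (c * (l / 2)\<^sup>2) * real n)"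
    using b by (simp add: rate_def powr_realpow[symmetric] powr_powr)
  have "exp_mean g n \<le> b powr - (real n * l / 2) + b powr (- c * (l / 2)\<^sup>2 * real n)"
    using dev n by (intro exp_mean_le[OF g n(2) lam]) (simp add: deviation_bound_def disp_def finite_drift_eq)
  also have "\<dots> \<le> rate l c ^ n + rate l c ^ n"
  proof (intro add_mono)
    have "min (l / 2) (c * (l / 2)\<^sup>2) * real n \<le> l / 2 * real n"
      by (intro mult_right_mono) auto
    then show "b powr - (real n * l / 2) \<le> rate l c ^ n"
      unfolding rate using b by (intro powr_mono) (auto simp: mult.commute)
    have "min (l / 2) (c * (l / 2)\<^sup>2) * real n \<le> c * (l / 2)\<^sup>2 * real n"
      by (intro mult_right_mono) auto
    then show "b powr (- c * (l / 2)\<^sup>2 * real n) \<le> rate l c ^ n"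
      unfolding rate using b by (intro powr_mono) auto
  qed
  finally show ?thesis by simp
qed

lemma uniform_estimates:
  assumes g: "ess_bounded g R" and pos: "0 < drift M T x0 g" and c: "0 < c"
    and dev: "deviation_bound g (drift M T x0 g / 4) c N0"
  obtains r K q N where "0 < r" "0 \<le> K" "0 < q" "q < 1"
    "\<And>h t n. ess_bounded h R \<Longrightarrow> deviation_bound h (drift M T x0 g / 4) c N0 \<Longrightarrow>
       AE \<omega> in M. isom_dist x0 b (g \<omega>) (h \<omega>) \<le> t \<Longrightarrow> t < r \<Longrightarrow> N \<le> n \<Longrightarrow>
       exp_mean h n \<le> 2 * q ^ n \<and>
       \<bar>drift M T x0 h - (mean_disp h (Suc n) - mean_disp h n)\<bar> \<le> K * q ^ n"
proof -
  define l where "l = drift M T x0 g"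
  \<comment> \<open>The growth rate required of the neighbours is l / 2, so the deviation that
    enters is l / 4.\<close>
  define q where "q = rate (l / 2) c"
  \<comment> \<open>From k = 1 on, a loss of l / 8 still leaves k l - l / 8 above k l / 2.\<close>
  define N where "N = max 1 N0"
  define K0 where "K0 = 2 * b powr (2 * R) / ln b * 2"
  define K where "K = K0 / (1 - q)"
  have l: "0 < l" using pos by (simp add: l_def)
  have q: "0 < q" "q < 1" using rate_bounds[of "l / 2" c] l c by (auto simp: q_def)
  have K0: "0 \<le> K0" using b by (simp add: K0_def)
  have K: "0 \<le> K" using K0 q by (simp add: K_def)
  have decay: "exp_mean h n \<le> 2 * q ^ n"
    if "ess_bounded h R" "deviation_bound h (l / 4) c N0" "N \<le> n" "real n * (l / 2) \<le> mean_disp h n" for h n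
    unfolding q_def using that ess_boundedD[OF that(1)]
    by (intro exp_mean_decay) (auto simp: N_def)
  have incr: "\<bar>(mean_disp h (Suc n) - mean_disp h n) - (mean_disp h (Suc (Suc n)) - mean_disp h (Suc n))\<bar> \<le> K0 * q ^ n"
    if "ess_bounded h R" "deviation_bound h (l / 4) c N0" "N \<le> n" "real n * (l / 2) \<le> mean_disp h n" for h n
  proof -
    have "2 * b powr (2 * R) / ln b * exp_mean h n \<le> 2 * b powr (2 * R) / ln b * (2 * q ^ n)"
      using decay[OF that] b by (intro mult_left_mono) auto
    then show ?thesis using mean_disp_increment_variation[OF that(1), of n] by (simp add: K0_def)
  qed
  have concl: "\<bar>drift M T x0 h - (mean_disp h (Suc n) - mean_disp h n)\<bar> \<le> K * q ^ n"
    if h: "ess_bounded h R" "deviation_bound h (l / 4) c N0" "N \<le> n"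
      "\<And>k. N \<le> k \<Longrightarrow> real k * (l / 2) \<le> mean_disp h k" for h n
  proof (rule average_limit_near_increment[OF drift_limit[OF h(1)]])
    fix m assume "n \<le> m"
    have "\<bar>(mean_disp h (Suc m) - mean_disp h m) - (mean_disp h (Suc n) - mean_disp h n)\<bar> \<le> K0 * q ^ n / (1 - q)"
      using \<open>n \<le> m\<close> q K0 h by (intro geometric_increments[of n m "\<lambda>k. mean_disp h (Suc k) - mean_disp h k"] incr) auto
    then show "\<bar>(mean_disp h (Suc m) - mean_disp h m) - (mean_disp h (Suc n) - mean_disp h n)\<bar> \<le> K * q ^ n"
      by (simp add: K_def)
  qed
  have "(\<lambda>n. K * q ^ n) \<longlonglongrightarrow> K * 0"
    using q by (intro tendsto_mult tendsto_const LIMSEQ_power_zero) auto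
  \<comment> \<open>The budget in units of l / 8: the increment of \<open>g\<close> at n is at least
    7, passing to \<open>h\<close> costs one each at n and at n + 1, and the later variation costs
    one more, which leaves the required 4.\<close>
  then have "\<forall>\<^sub>F n in sequentially. K * q ^ n < l / 8"
    using l by (intro order_tendstoD) auto
  then obtain n1 where n1: "\<And>n. n1 \<le> n \<Longrightarrow> K * q ^ n < l / 8"
    unfolding eventually_sequentially by blast
  define n where "n = max N n1"
  have n: "N \<le> n" "K * q ^ n < l / 8" using n1[of n] by (auto simp: n_def)
  define d where "d = 2 / ln b * growth R ^ Suc n"
  \<comment> \<open>Chosen so that \<open>mean_disp\<close> changes by at most l / 8 up to time n +
    1, which the increment at n involves.\<close>
  define r where "r = l / 8 / d"
  have R: "0 \<le> R" by (rule ess_bounded_nonneg[OF g])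
  have gr: "1 \<le> growth R" using growth_ge_2[OF R] by simp
  have d: "0 < d" unfolding d_def using gr b by (intro mult_pos_pos divide_pos_pos zero_less_power) auto
  then have r: "0 < r" using l by (simp add: r_def)
  have g_low: "real k * l \<le> mean_disp g k" for k
    using drift_le_mean_disp[OF g] by (simp add: l_def)
  \<comment> \<open>For \<open>g\<close> itself the growth holds at all times, because its drift is
    the infimum of the averages.\<close>
  have "real k * (l / 2) \<le> mean_disp g k" for k
    using g_low[of k] mult_nonneg_nonneg[OF of_nat_0_le_iff less_imp_le[OF l], of k] by linarith
  then have ag: "7 / 8 * l \<le> mean_disp g (Suc n) - mean_disp g n"
    using concl[of g n] g dev n by (simp add: l_def)
  have low: "real k * (l / 2) \<le> mean_disp h k"
    if h: "ess_bounded h R" "deviation_bound h (l / 4) c N0"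
      and t: "AE \<omega> in M. isom_dist x0 b (g \<omega>) (h \<omega>) \<le> t" "t < r" and "N \<le> k" for h t k
  proof -
    have close: "\<bar>mean_disp g j - mean_disp h j\<bar> \<le> l / 8" if "j \<le> Suc n" for j
    proof -
      have "AE \<omega> in M. 0 \<le> t" using t(1) by eventually_elim (rule order_trans[OF isom_dist_nonneg])
      then have t0: "0 \<le> t" by simp
      have "\<bar>mean_disp g j - mean_disp h j\<bar> \<le> 2 / ln b * growth R ^ j * t"
        by (rule mean_disp_lipschitz[OF g h(1) t(1)])
      also have "\<dots> \<le> 2 / ln b * growth R ^ Suc n * r"
        using that gr b t(2) t0 by (intro mult_mono power_increasing) auto
      also have "\<dots> = l / 8" using d unfolding d_def[symmetric] by (simp add: r_def)
      finally show ?thesis .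
    qed
    show ?thesis
    proof (rule linear_growth_bootstrap[where K = K0 and q = q and N = N and n = n and F = "mean_disp h"])
      fix k assume k: "N \<le> k" "k \<le> n"
      have "1 \<le> real k" using k by (simp add: N_def)
      then have "1 * (l / 2) \<le> real k * (l / 2)" using l by (intro mult_right_mono) auto
      moreover have "real k * l - l / 8 \<le> mean_disp h k" using close[of k] g_low[of k] k by linarith
      ultimately show "real k * (l / 2) \<le> mean_disp h k" using l by linarith
    next
      have "mean_disp g (Suc n) - mean_disp g n - l / 4 \<le> mean_disp h (Suc n) - mean_disp h n"
        using close[of n] close[of "Suc n"] by linarith
      moreover have "K0 * q ^ n / (1 - q) < l / 8" using n(2) by (simp add: K_def)
      ultimately show "l / 2 + K0 * q ^ n / (1 - q) \<le> mean_disp h (Suc n) - mean_disp h n"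
        using ag by linarith
    qed (use n q K0 \<open>N \<le> k\<close> incr[OF h] in auto)
  qed
  show ?thesis
  proof (rule that[OF r K q, of N], fold l_def)
    fix h t n
    assume h: "ess_bounded h R" "deviation_bound h (l / 4) c N0"
      "AE \<omega> in M. isom_dist x0 b (g \<omega>) (h \<omega>) \<le> t" "t < r" "N \<le> n"
    note lw = low[OF h(1-4)]
    show "exp_mean h n \<le> 2 * q ^ n \<and>
       \<bar>drift M T x0 h - (mean_disp h (Suc n) - mean_disp h n)\<bar> \<le> K * q ^ n"
      using decay[OF h(1,2,5) lw[OF h(5)]] concl[OF h(1,2,5) lw] by blast
  qed
qed

lemma drift_diff_le:
  assumes g1: "ess_bounded g1 R" and g2: "ess_bounded g2 R"
    and t: "AE \<omega> in M. isom_dist x0 b (g1 \<omega>) (g2 \<omega>) \<le> t"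
    and d1: "\<bar>drift M T x0 g1 - (mean_disp g1 (Suc n) - mean_disp g1 n)\<bar> \<le> K * q ^ n"
    and d2: "\<bar>drift M T x0 g2 - (mean_disp g2 (Suc n) - mean_disp g2 n)\<bar> \<le> K * q ^ n"
  shows "\<bar>drift M T x0 g1 - drift M T x0 g2\<bar> \<le> 2 * K * q ^ n + 2 / ln b * (growth R + 1) * (growth R ^ n * t)"
proof -
  have "2 / ln b * growth R ^ Suc n * t + 2 / ln b * growth R ^ n * t
      = 2 / ln b * (growth R + 1) * (growth R ^ n * t)"
    by (simp add: algebra_simps add_divide_distrib)
  then show ?thesis
    using mean_disp_lipschitz[OF g1 g2 t, of n] mean_disp_lipschitz[OF g1 g2 t, of "Suc n"] d1 d2
    by linarith
qed

section \<open>Convergence to the hitting point and its measurability\<close>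

lemma powr_disp_summable:
  assumes g: "isom_measurable g" and q: "0 < q" "q < 1"
    and decay: "\<And>n. N \<le> n \<Longrightarrow> exp_mean g n \<le> 2 * q ^ n" and n: "N \<le> n"
  shows "AE \<omega> in M. summable (\<lambda>k. b powr - disp g k \<omega>)"
    and "integrable M (\<lambda>\<omega>. \<Sum>k. b powr - disp g (k + n) \<omega>)"
    and "(\<integral>\<omega>. (\<Sum>k. b powr - disp g (k + n) \<omega>) \<partial>M) \<le> 2 * q ^ n / (1 - q)"
proof -
  have e0: "0 \<le> exp_mean g k" for k by (simp add: exp_mean_def)
  have geo: "(\<lambda>k. 2 * q ^ (k + n)) sums (2 * q ^ n / (1 - q))"
    using sums_mult[OF geometric_sums[of q], of "2 * q ^ n"] q by (simp add: power_add mult_ac)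
  have le: "exp_mean g (k + n) \<le> 2 * q ^ (k + n)" for k using decay n by simp
  have s: "summable (\<lambda>k. exp_mean g (k + n))"
    by (rule summable_comparison_test'[OF sums_summable[OF geo]]) (use le e0 in auto)
  have AE: "AE \<omega> in M. summable (\<lambda>k. b powr - disp g (k + n) \<omega>)"
    using s powr_disp_integrable[OF g] by (intro AE_summable_of_summable_integral) (auto simp: exp_mean_def)
  then show "AE \<omega> in M. summable (\<lambda>k. b powr - disp g k \<omega>)"
    by (simp add: summable_iff_shift[of "\<lambda>k. b powr - disp g k _"])
  show "integrable M (\<lambda>\<omega>. \<Sum>k. b powr - disp g (k + n) \<omega>)"
    using AE s powr_disp_integrable[OF g] by (intro integrable_suminf) (auto simp: exp_mean_def)
  have "(\<integral>\<omega>. (\<Sum>k. b powr - disp g (k + n) \<omega>) \<partial>M) = (\<Sum>k. exp_mean g (k + n))"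
    using AE s powr_disp_integrable[OF g] unfolding exp_mean_def by (intro integral_suminf) auto
  also have "\<dots> \<le> (\<Sum>k. 2 * q ^ (k + n))"
    by (rule suminf_le[OF le s sums_summable[OF geo]])
  also have "\<dots> = 2 * q ^ n / (1 - q)" using geo by (simp add: sums_iff)
  finally show "(\<integral>\<omega>. (\<Sum>k. b powr - disp g (k + n) \<omega>) \<partial>M) \<le> 2 * q ^ n / (1 - q)" .
qed

text \<open>The orbit moves at time k by at most b^R b^(-f_k) in the visual distance, and these
  steps are almost surely summable because their means are.\<close>

lemma AE_hitting_point:
  assumes g: "ess_bounded g R" and q: "0 < q" "q < 1"
    and decay: "\<And>n. N \<le> n \<Longrightarrow> exp_mean g n \<le> 2 * q ^ n"
  shows "AE \<omega> in M. gromov_seq x0 (\<lambda>n. cocycle T g n \<omega> x0) \<and>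
    (\<forall>n. rho x0 b (Inner (cocycle T g n \<omega> x0)) (hitting_point T x0 g \<omega>)
       \<le> b powr R * (\<Sum>k. b powr - disp g (k + n) \<omega>))"
proof -
  have "AE \<omega> in M. summable (\<lambda>k. b powr - disp g k \<omega>)"
    by (rule powr_disp_summable(1)[OF ess_boundedD[OF g] q decay order_refl])
  with ess_bounded_orbit[OF g] show ?thesis
  proof eventually_elim
    case (elim \<omega>)
    have C: "1 \<le> b powr R" using powr_mono[of 0 R b] b ess_bounded_nonneg[OF g] by simp
    have step: "vis (cocycle T g k \<omega> x0) (cocycle T g (Suc k) \<omega> x0) \<le> b powr R * b powr - disp g k \<omega>" for k
      using elim(1) by (intro vis_cocycle_Suc_le) blast+
    have diag: "vis (cocycle T g k \<omega> x0) (cocycle T g k \<omega> x0) \<le> b powr - disp g k \<omega>" for k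
      by (simp add: gromov_prod_def disp_def dist_commute)
    note conv = summable_steps_converge[where x = "\<lambda>n. cocycle T g n \<omega> x0" and s = "\<lambda>k. b powr - disp g k \<omega>",
      OF elim(2) powr_ge_zero C step diag]
    show ?case using conv by (simp add: hitting_point_limit_pt)
  qed
qed

text \<open>The path from one hitting point to the other passes through the two orbit points at time
  \<open>n\<close>. The outer legs are tails of geometric mean size, and the middle leg is the
  Lipschitz dependence at a fixed time plus the self-distance term.\<close>

lemma dist_one_hitting_point_le:
  assumes g1: "ess_bounded g1 R" and g2: "ess_bounded g2 R"
    and t: "AE \<omega> in M. isom_dist x0 b (g1 \<omega>) (g2 \<omega>) \<le> t"
    and q: "0 < q" "q < 1" and n: "N \<le> n"
    and d1: "\<And>n. N \<le> n \<Longrightarrow> exp_mean g1 n \<le> 2 * q ^ n"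
    and d2: "\<And>n. N \<le> n \<Longrightarrow> exp_mean g2 n \<le> 2 * q ^ n"
  shows "dist_one M x0 b (hitting_point T x0 g1) (hitting_point T x0 g2)
    \<le> (2 * b powr R * (2 / (1 - q)) + 2 * b) * q ^ n + 2 / ln b * (growth R ^ n * t)"
proof -
  define S where "S g \<omega> = (\<Sum>k. b powr - disp g (k + n) \<omega>)" for g \<omega>
  define D where "D = 2 / ln b * growth R ^ n * t"
  let ?B = "\<lambda>\<omega>. b powr R * S g1 \<omega> + (b * b powr - disp g1 n \<omega> + D) + b powr R * S g2 \<omega>"
  note S1 = powr_disp_summable(2,3)[OF ess_boundedD[OF g1] q d1 n, folded S_def]
  note S2 = powr_disp_summable(2,3)[OF ess_boundedD[OF g2] q d2 n, folded S_def]
  note E1 = powr_disp_integrable[OF ess_boundedD[OF g1], of n]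
  have H: "AE \<omega> in M. gromov_seq x0 (\<lambda>n. cocycle T g n \<omega> x0) \<and>
      (\<forall>n. rho x0 b (Inner (cocycle T g n \<omega> x0)) (hitting_point T x0 g \<omega>)
         \<le> b powr R * (\<Sum>k. b powr - disp g (k + n) \<omega>))" if "g = g1 \<or> g = g2" for g
    using AE_hitting_point[OF g1 q d1] AE_hitting_point[OF g2 q d2] that by auto
  have "dist_one M x0 b (hitting_point T x0 g1) (hitting_point T x0 g2) \<le> (\<integral>\<omega>. ?B \<omega> \<partial>M)"
    unfolding dist_one_def
  proof (rule integral_le_of_AE_le)
    show "integrable M ?B" using S1(1) S2(1) E1 by simp
    show "AE \<omega> in M. rho x0 b (hitting_point T x0 g1 \<omega>) (hitting_point T x0 g2 \<omega>) \<le> ?B \<omega>"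
      using H[OF disjI1[OF refl]] H[OF disjI2[OF refl]] AE_dist_cocycle_le[OF g1 g2 t, of n]
    proof eventually_elim
      case (elim \<omega>)
      let ?y = "Inner (cocycle T g1 n \<omega> x0)" and ?z = "Inner (cocycle T g2 n \<omega> x0)"
      let ?\<xi> = "hitting_point T x0 g1 \<omega>" and ?\<eta> = "hitting_point T x0 g2 \<omega>"
      have bd: "?\<xi> \<in> bord x0" "?\<eta> \<in> bord x0"
        using elim boundary_iff boundary_bord by (auto simp: hitting_point_limit_pt)
      have "rho x0 b ?\<xi> ?\<eta> \<le> rho x0 b ?\<xi> ?y + (rho x0 b ?y ?z + rho x0 b ?z ?\<eta>)"
        using rho_triangle[OF bd(1) Inner_bord bd(2), of "cocycle T g1 n \<omega> x0"]
          rho_triangle[OF Inner_bord Inner_bord bd(2), of "cocycle T g1 n \<omega> x0" "cocycle T g2 n \<omega> x0"] by linarith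
      moreover have "rho x0 b ?\<xi> ?y \<le> b powr R * S g1 \<omega>"
        using elim(1) rho_commute[of x0 b ?\<xi> ?y] by (simp add: S_def)
      moreover have "rho x0 b ?z ?\<eta> \<le> b powr R * S g2 \<omega>"
        using elim(2) by (simp add: S_def)
      moreover have "rho x0 b ?y ?z \<le> b * b powr - disp g1 n \<omega> + D"
        using vis_le_powr_plus_dist[of "cocycle T g1 n \<omega> x0" "cocycle T g2 n \<omega> x0"] elim(3)
        unfolding rho_Inner disp_def D_def by linarith
      ultimately show ?case by linarith
    qed
  qed (simp add: rho_nonneg)
  also have "\<dots> = b powr R * (\<integral>\<omega>. S g1 \<omega> \<partial>M) + (b * exp_mean g1 n + D) + b powr R * (\<integral>\<omega>. S g2 \<omega> \<partial>M)"
    using S1(1) S2(1) E1 by (simp add: exp_mean_def prob_space)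
  also have "\<dots> \<le> b powr R * (2 * q ^ n / (1 - q)) + (b * (2 * q ^ n) + D) + b powr R * (2 * q ^ n / (1 - q))"
    using S1(2) S2(2) d1[OF n] b by (intro add_mono mult_left_mono) auto
  also have "\<dots> = (2 * b powr R * (2 / (1 - q)) + 2 * b) * q ^ n + 2 / ln b * (growth R ^ n * t)"
    by (simp add: D_def algebra_simps)
  finally show ?thesis .
qed

text \<open>A limit point lies in an open set \<open>U\<close> iff the sequence eventually stays at a definite
  visual distance from the complement of \<open>U\<close>. In terms of points of the space
  this distance is a closed condition, so no separability of the boundary is needed.\<close>

lemma hitting_point_measurable:
  assumes g: "isom_measurable g" and G: "AE \<omega> in M. gromov_seq x0 (\<lambda>n. cocycle T g n \<omega> x0)"
  shows "hitting_point T x0 g \<in> S_one M x0 b"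
proof -
  interpret B: Metric_space "boundary x0" "rho x0 b" by (rule Metric_space_boundary)
  define y where "y n \<omega> = cocycle T g n \<omega> x0" for n \<omega>
  have y[measurable]: "y n \<in> borel_measurable M" for n
    unfolding y_def using cocycle_measurable[OF g] by simp
  have [measurable]: "(\<lambda>\<omega>. dist (y m \<omega>) (y n \<omega>)) \<in> borel_measurable M" "(\<lambda>\<omega>. dist (y m \<omega>) x0) \<in> borel_measurable M"
    "(\<lambda>\<omega>. dist x0 (y m \<omega>)) \<in> borel_measurable M" for m n
    by (rule borel_measurable_dist_separable[OF sep]; measurable)+
  have vis_meas [measurable]: "(\<lambda>\<omega>. vis (y m \<omega>) (y n \<omega>)) \<in> borel_measurable M" for m n
    unfolding gromov_prod_def by measurable
  define A where "A = {\<omega> \<in> space M. gromov_seq x0 (\<lambda>n. y n \<omega>)}"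
  \<comment> \<open>Tolerances 1 / (j + 1) make the Cauchy condition countable.\<close>
  have "gromov_seq x0 x \<longleftrightarrow> (\<forall>j. \<exists>N. \<forall>m\<ge>N. \<forall>n\<ge>N. vis (x m) (x n) < inverse (real (Suc j)))" for x
  proof
    assume "gromov_seq x0 x"
    then show "\<forall>j. \<exists>N. \<forall>m\<ge>N. \<forall>n\<ge>N. vis (x m) (x n) < inverse (real (Suc j))"
      unfolding gromov_seq_iff by simp
  next
    assume *: "\<forall>j. \<exists>N. \<forall>m\<ge>N. \<forall>n\<ge>N. vis (x m) (x n) < inverse (real (Suc j))"
    show "gromov_seq x0 x"
      unfolding gromov_seq_iff
    proof (intro allI impI)
      fix e :: real assume "0 < e"
      then obtain j where "inverse (real (Suc j)) < e" using reals_Archimedean by blast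
      with * show "\<exists>N. \<forall>m\<ge>N. \<forall>n\<ge>N. vis (x m) (x n) < e" by (meson order.strict_trans)
    qed
  qed
  then have "A = {\<omega> \<in> space M. \<forall>j. \<exists>N. \<forall>m\<in>{N..}. \<forall>n\<in>{N..}. vis (y m \<omega>) (y n \<omega>) < inverse (real (Suc j))}"
    by (simp add: A_def Ball_def)
  also have "\<dots> \<in> sets M" by measurable
  finally have A [measurable]: "A \<in> sets M" .
  have hA: "hitting_point T x0 g \<omega> = limit_pt (\<lambda>n. y n \<omega>)" "gromov_seq x0 (\<lambda>n. y n \<omega>)" if "\<omega> \<in> A" for \<omega>
    using that hitting_point_limit_pt[of T g \<omega>] by (auto simp: A_def y_def)
  \<comment> \<open>A single convergent orbit shows that the boundary is nonempty, so the default
    value taken outside \<open>A\<close> lies in it.\<close>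
  obtain \<omega>0 where "\<omega>0 \<in> A"
  proof -
    have "A \<noteq> {}"
    proof
      assume "A = {}"
      with G have "AE \<omega> in M. False"
        by (elim AE_mp, intro AE_I2) (auto simp: A_def y_def)
      then show False by (simp add: AE_False)
    qed
    then show ?thesis using that by blast
  qed
  then have "limit_pt (\<lambda>n. y n \<omega>0) \<in> boundary x0" using hA boundary_iff by blast
  define \<xi>0 where "\<xi>0 = (SOME \<xi>. \<xi> \<in> boundary x0)"
  have \<xi>0: "\<xi>0 \<in> boundary x0" unfolding \<xi>0_def using \<open>limit_pt _ \<in> boundary x0\<close> by (rule someI)
  have hN: "hitting_point T x0 g \<omega> = \<xi>0" if "\<omega> \<in> space M - A" for \<omega>
    using that by (auto simp: A_def y_def hitting_point_def \<xi>0_def)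
  have bd: "hitting_point T x0 g \<omega> \<in> boundary x0" if "\<omega> \<in> space M" for \<omega>
    using hA[of \<omega>] hN[of \<omega>] \<xi>0 boundary_iff that by (cases "\<omega> \<in> A") auto
  have pre: "hitting_point T x0 g -` U \<inter> space M \<in> sets M" if U: "openin B.mtopology U" for U
  proof -
    \<comment> \<open>Points at visual distance at least 1 / (j + 1) from every boundary point
      outside \<open>U\<close>. The union may be uncountable, but its members are open.\<close>
    define V where "V j = - (\<Union>\<eta>\<in>boundary x0 - U. {z. rho x0 b (Inner z) \<eta> < inverse (real (Suc j))})" for j
    have V_iff: "z \<in> V j \<longleftrightarrow> (\<forall>\<eta>\<in>boundary x0 - U. inverse (real (Suc j)) \<le> rho x0 b (Inner z) \<eta>)" for z j
      unfolding V_def Compl_iff UN_iff mem_Collect_eq not_less[symmetric] by blast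
    have "closed (V j)" for j
      unfolding V_def closed_def double_complement by (intro open_UN ballI open_rho_less)
    then have V [measurable]: "V j \<in> sets borel" for j by (rule borel_closed)
    have mem: "limit_pt (\<lambda>n. y n \<omega>) \<in> U \<longleftrightarrow> (\<exists>j N. \<forall>n\<in>{N..}. y n \<omega> \<in> V j)" if "\<omega> \<in> A" for \<omega>
    proof
      let ?\<xi> = "limit_pt (\<lambda>n. y n \<omega>)"
      note conv = rho_limit_pt_tendsto[OF hA(2)[OF that]]
      have \<xi>: "?\<xi> \<in> boundary x0" using hA[OF that] boundary_iff by blast
      {
        assume "?\<xi> \<in> U"
        then obtain r where r: "0 < r" "B.mball ?\<xi> r \<subseteq> U"
          using U unfolding B.openin_mtopology by blast
        have far: "r \<le> rho x0 b ?\<xi> \<eta>" if "\<eta> \<in> boundary x0 - U" for \<eta>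
          using r(2) that \<xi> by (force simp: B.in_mball)
        obtain j where j: "inverse (real (Suc j)) < r / 2"
          using reals_Archimedean[of "r / 2"] r(1) by auto
        obtain N where N: "\<And>n. N \<le> n \<Longrightarrow> rho x0 b (Inner (y n \<omega>)) ?\<xi> < r / 2"
          using conv[OF half_gt_zero[OF r(1)]] unfolding eventually_sequentially by blast
        have "y n \<omega> \<in> V j" if "N \<le> n" for n
          unfolding V_iff
        proof
          fix \<eta> assume \<eta>: "\<eta> \<in> boundary x0 - U"
          have "rho x0 b ?\<xi> \<eta> \<le> rho x0 b ?\<xi> (Inner (y n \<omega>)) + rho x0 b (Inner (y n \<omega>)) \<eta>"
            using \<xi> \<eta> by (intro rho_triangle boundary_bord Inner_bord) auto
          then show "inverse (real (Suc j)) \<le> rho x0 b (Inner (y n \<omega>)) \<eta>"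
            using far[OF \<eta>] N[OF that] j rho_commute[of x0 b ?\<xi> "Inner (y n \<omega>)"] by linarith
        qed
        then show "\<exists>j N. \<forall>n\<in>{N..}. y n \<omega> \<in> V j" by auto
      next
        assume "\<exists>j N. \<forall>n\<in>{N..}. y n \<omega> \<in> V j"
        then obtain j N where jN: "\<And>n. N \<le> n \<Longrightarrow> y n \<omega> \<in> V j" by auto
        obtain N' where N': "\<And>n. N' \<le> n \<Longrightarrow> rho x0 b (Inner (y n \<omega>)) ?\<xi> < inverse (real (Suc j))"
          using conv[of "inverse (real (Suc j))"] unfolding eventually_sequentially by auto
        show "?\<xi> \<in> U"
        proof (rule ccontr)
          assume "?\<xi> \<notin> U"
          then have "inverse (real (Suc j)) \<le> rho x0 b (Inner (y (max N N') \<omega>)) ?\<xi>"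
            using jN[of "max N N'"] \<xi> by (simp add: V_iff)
          then show False using N'[of "max N N'"] by simp
        qed
      }
    qed
    have iff: "hitting_point T x0 g \<omega> \<in> U \<longleftrightarrow>
        (if \<omega> \<in> A then \<exists>j N. \<forall>n\<in>{N..}. y n \<omega> \<in> V j else \<xi>0 \<in> U)" if "\<omega> \<in> space M" for \<omega>
      using mem[of \<omega>] hA(1)[of \<omega>] hN[of \<omega>] that by (cases "\<omega> \<in> A") simp_all
    have "A \<subseteq> space M" by (auto simp: A_def)
    have "hitting_point T x0 g -` U \<inter> space M
        = {\<omega> \<in> A. \<exists>j N. \<forall>n\<in>{N..}. y n \<omega> \<in> V j} \<union> {\<omega> \<in> space M - A. \<xi>0 \<in> U}"
    proof (rule set_eqI)
      fix \<omega>
      show "\<omega> \<in> hitting_point T x0 g -` U \<inter> space M \<longleftrightarrow>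
          \<omega> \<in> {\<omega> \<in> A. \<exists>j N. \<forall>n\<in>{N..}. y n \<omega> \<in> V j} \<union> {\<omega> \<in> space M - A. \<xi>0 \<in> U}"
        using iff[of \<omega>] \<open>A \<subseteq> space M\<close> by (cases "\<omega> \<in> A") auto
    qed
    also have "{\<omega> \<in> A. \<exists>j N. \<forall>n\<in>{N..}. y n \<omega> \<in> V j}
        = A \<inter> {\<omega> \<in> space M. \<exists>j N. \<forall>n\<in>{N..}. y n \<omega> \<in> V j}"
      by (auto simp: A_def)
    also have "\<dots> \<union> {\<omega> \<in> space M - A. \<xi>0 \<in> U} \<in> sets M"
      by (cases "\<xi>0 \<in> U") measurable
    finally show ?thesis .
  qed
  have sub: "{U. openin B.mtopology U} \<subseteq> Pow (boundary x0)"
    using openin_subset[of B.mtopology] by auto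
  show ?thesis
    unfolding S_one_def metric_borel_def
    using bd pre by (intro measurable_measure_of[OF sub]) auto
qed

end

section \<open>Local Hoelder continuity\<close>

lemma two_term_le:
  fixes u v p w :: real
  assumes "0 \<le> u" "0 \<le> v" "0 \<le> p" "0 \<le> w"
  shows "u * p + v * w \<le> (u + v) * (p + w)"
  using assms by (simp add: algebra_simps)

lemma locally_hoelderI:
  assumes "Metric_space A d"
    and loc: "\<And>a. a \<in> A \<Longrightarrow> \<exists>r>0. \<exists>\<alpha>>0. \<exists>K>0. \<forall>x\<in>A. \<forall>y\<in>A. d a x < r \<longrightarrow> d a y < r \<longrightarrow>
      dB (f x) (f y) \<le> K * d x y powr \<alpha>"
  shows "locally_hoelder A d dB f"
  unfolding locally_hoelder_def
proof
  interpret Metric_space A d by fact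
  fix a assume a: "a \<in> A"
  from loc[OF a] obtain r \<alpha> K where r: "0 < r" and \<alpha>: "0 < \<alpha>" and K: "0 < K"
    and le: "\<forall>x\<in>A. \<forall>y\<in>A. d a x < r \<longrightarrow> d a y < r \<longrightarrow> dB (f x) (f y) \<le> K * d x y powr \<alpha>" by blast
  show "\<exists>U. openin mtopology U \<and> a \<in> U \<and>
      (\<exists>\<alpha>>0. \<exists>K>0. \<forall>x\<in>U. \<forall>y\<in>U. dB (f x) (f y) \<le> K * d x y powr \<alpha>)"
  proof (intro exI[of _ "mball a r"] conjI)
    show "openin mtopology (mball a r)" "a \<in> mball a r" using a r by auto
    show "\<exists>\<alpha>>0. \<exists>K>0. \<forall>x\<in>mball a r. \<forall>y\<in>mball a r. dB (f x) (f y) \<le> K * d x y powr \<alpha>"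
      using \<alpha> K le by (intro exI[of _ \<alpha>] conjI exI[of _ K]) auto
  qed
qed

section \<open>Neighbourhoods in a class of cocycles\<close>

locale cocycle_class = cocycle_system x0 b M T
  for x0 :: "'x::metric_space" and b :: real and M :: "'w measure" and T :: "'w \<Rightarrow> 'w" +
  fixes C :: "('w \<Rightarrow> 'x \<Rightarrow> 'x) set set"
    and dC :: "('w \<Rightarrow> 'x \<Rightarrow> 'x) set \<Rightarrow> ('w \<Rightarrow> 'x \<Rightarrow> 'x) set \<Rightarrow> real"
  assumes C_sub: "C \<subseteq> S_infty M x0 b" and metric_C: "Metric_space C dC"
    and dC_dominates: "\<And>g1 g2. g1 \<in> C \<Longrightarrow> g2 \<in> C \<Longrightarrow> ereal (dC g1 g2) \<ge> dist_infty M x0 b (rep g1) (rep g2)"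
    and LDE: "\<And>g. g \<in> positive_drift M T x0 C \<Longrightarrow> uniform_LDE M T x0 b C dC g"
begin

lemma rep_bounded_cocycles:
  assumes "g \<in> C" shows "rep g \<in> bounded_cocycles M x0 b"
proof -
  let ?R = "{(g1, g2). g1 \<in> bounded_cocycles M x0 b \<and> g2 \<in> bounded_cocycles M x0 b \<and>
        dist_infty M x0 b g1 g2 = 0}"
  have "g \<in> bounded_cocycles M x0 b // ?R"
    using assms C_sub by (auto simp: S_infty_def)
  then obtain a where a: "a \<in> bounded_cocycles M x0 b" "g = ?R `` {a}"
    by (rule quotientE)
  \<comment> \<open>Reflexivity at \<open>a\<close> makes the class nonempty, so that
    \<open>rep\<close> chooses a genuine member.\<close>
  have "dist_infty M x0 b a a = 0"
    by (simp add: dist_infty_def isom_dist_self zero_ereal_def[symmetric] esssup_const emeasure_space_1)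
  then have "a \<in> g" using a by auto
  then have "rep g \<in> g" unfolding rep_def by (rule someI[of "\<lambda>h. h \<in> g"])
  then show ?thesis using a by auto
qed

lemma rep_ess_bounded:
  assumes "g \<in> C" obtains R where "ess_bounded (rep g) R"
proof -
  note g = rep_bounded_cocycles[OF assms]
  then obtain K where K: "\<And>\<omega>. \<omega> \<in> space M \<Longrightarrow> b powr dist (rep g \<omega> x0) x0 \<le> K"
    by (auto simp: bounded_cocycles_def bdd_above_def)
  have "dist (rep g \<omega> x0) x0 \<le> log b K" if "\<omega> \<in> space M" for \<omega>
  proof -
    have "0 < b powr dist (rep g \<omega> x0) x0" using b by simp
    also note K[OF that]
    finally show ?thesis using K[OF that] b by (subst le_log_iff) auto
  qed
  then have "ess_bounded (rep g) (log b K)"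
    using g by (auto simp: ess_bounded_def bounded_cocycles_def)
  then show ?thesis by (rule that)
qed

lemma AE_isom_dist_le:
  assumes "g \<in> C" "h \<in> C"
  shows "AE \<omega> in M. isom_dist x0 b (rep g \<omega>) (rep h \<omega>) \<le> dC g h"
  using esssup_AE[of "\<lambda>\<omega>. ereal (isom_dist x0 b (rep g \<omega>) (rep h \<omega>))" M]
proof eventually_elim
  case (elim \<omega>)
  also have "esssup M (\<lambda>\<omega>. ereal (isom_dist x0 b (rep g \<omega>) (rep h \<omega>))) \<le> ereal (dC g h)"
    using dC_dominates[OF assms] by (simp add: dist_infty_def)
  finally show ?case by simp
qed

text \<open>Members of the class are bounded individually, but a neighbourhood needs a common bound.
  Below b^(-R) the metric on the group controls the displacement of \<open>x0\<close>, and as b^(-R)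
  \<le> 1 the images of \<open>x0\<close> differ by at most \<open>1 / ln b\<close>.\<close>

lemma nearby_ess_bounded:
  assumes g: "g \<in> C" and h: "h \<in> C" and R: "ess_bounded (rep g) R" and near: "dC g h < b powr - R"
  shows "ess_bounded (rep h) (R + 1 / ln b)"
proof -
  have "AE \<omega> in M. dist (rep g \<omega> x0) x0 \<le> R" using R by (simp add: ess_bounded_def)
  with AE_isom_dist_le[OF g h] have "AE \<omega> in M. dist (rep h \<omega> x0) x0 \<le> R + 1 / ln b"
  proof eventually_elim
    case (elim \<omega>)
    have small: "isom_dist x0 b (rep g \<omega>) (rep h \<omega>) < b powr - R" using elim near by simp
    also have "b powr - R \<le> 1"
      using powr_mono[of "-R" 0 b] b ess_bounded_nonneg[OF R] by simp
    finally have "isom_dist x0 b (rep g \<omega>) (rep h \<omega>) / ln b \<le> 1 / ln b"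
      using b by (intro divide_right_mono) auto
    then have "dist (rep g \<omega> x0) (rep h \<omega> x0) \<le> 1 / ln b"
      using dist_le_of_isom_dist_small[OF elim(2) small] by simp
    then show ?case
      using dist_triangle[of "rep h \<omega> x0" x0 "rep g \<omega> x0"] elim(2)
      by (simp add: dist_commute)
  qed
  then show ?thesis
    using rep_bounded_cocycles[OF h] by (simp add: ess_bounded_def bounded_cocycles_def)
qed

text \<open>The order of choices matters: the common bound \<open>R\<close> comes before the rates,
  which depend on it, and the deviation is fixed at a quarter of the drift of \<open>g\<close>, so
  that one threshold serves all cocycles nearby.\<close>

lemma local_estimates:
  assumes "g \<in> positive_drift M T x0 C"
  obtains R r K q N where "0 \<le> R" "0 < r" "0 \<le> K" "0 < q" "q < 1"
    "\<And>h. h \<in> C \<Longrightarrow> dC g h < r \<Longrightarrow> ess_bounded (rep h) R"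
    "\<And>h n. h \<in> C \<Longrightarrow> dC g h < r \<Longrightarrow> N \<le> n \<Longrightarrow> exp_mean (rep h) n \<le> 2 * q ^ n"
    "\<And>h n. h \<in> C \<Longrightarrow> dC g h < r \<Longrightarrow> N \<le> n \<Longrightarrow>
      \<bar>drift M T x0 (rep h) - (mean_disp (rep h) (Suc n) - mean_disp (rep h) n)\<bar> \<le> K * q ^ n"
proof -
  interpret C: Metric_space C dC by (rule metric_C)
  have g: "g \<in> C" and pos: "0 < drift M T x0 (rep g)" using assms by (auto simp: positive_drift_def)
  obtain R0 where R0: "ess_bounded (rep g) R0" using rep_ess_bounded[OF g] .
  define R where "R = R0 + 1 / ln b"
  have "R0 \<le> R" using b by (simp add: R_def)
  have gR: "ess_bounded (rep g) R" by (rule ess_bounded_mono[OF R0 \<open>R0 \<le> R\<close>])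
  obtain r1 c N0 where r1: "0 < r1" and c: "0 < c"
    and dev: "\<And>h. h \<in> C \<Longrightarrow> dC g h < r1 \<Longrightarrow> deviation_bound (rep h) (drift M T x0 (rep g) / 4) c N0"
  proof -
    obtain r c where rc: "0 < r" "0 < c"
      "\<forall>\<epsilon>>0. \<exists>N. \<forall>g1\<in>C. dC g g1 < r \<longrightarrow> deviation_bound (rep g1) \<epsilon> c N"
      using LDE[OF assms] unfolding uniform_LDE_def deviation_bound_def by blast
    have "0 < drift M T x0 (rep g) / 4" using pos by simp
    with rc(3) obtain N where "\<forall>g1\<in>C. dC g g1 < r \<longrightarrow> deviation_bound (rep g1) (drift M T x0 (rep g) / 4) c N"
      by blast
    then show ?thesis using that[of r c N] rc(1,2) by blast
  qed
  have "deviation_bound (rep g) (drift M T x0 (rep g) / 4) c N0"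
    using dev[OF g] r1 g by simp
  from uniform_estimates[OF gR pos c this] obtain r2 K q N where r2: "0 < r2" and K: "0 \<le> K"
    and q: "0 < q" "q < 1"
    and est: "\<And>h t n. ess_bounded h R \<Longrightarrow> deviation_bound h (drift M T x0 (rep g) / 4) c N0 \<Longrightarrow>
       AE \<omega> in M. isom_dist x0 b (rep g \<omega>) (h \<omega>) \<le> t \<Longrightarrow> t < r2 \<Longrightarrow> N \<le> n \<Longrightarrow>
       exp_mean h n \<le> 2 * q ^ n \<and> \<bar>drift M T x0 h - (mean_disp h (Suc n) - mean_disp h n)\<bar> \<le> K * q ^ n"
    by blast
  \<comment> \<open>The radii of the large deviation estimate, of the growth argument and of the
    common bound.\<close>
  define r where "r = min (min r1 r2) (b powr - R0)"
  have r: "0 < r" using r1 r2 b by (simp add: r_def)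
  have eb: "ess_bounded (rep h) R" if "h \<in> C" "dC g h < r" for h
    unfolding R_def using that by (intro nearby_ess_bounded[OF g _ R0]) (auto simp: r_def)
  have "exp_mean (rep h) n \<le> 2 * q ^ n \<and>
      \<bar>drift M T x0 (rep h) - (mean_disp (rep h) (Suc n) - mean_disp (rep h) n)\<bar> \<le> K * q ^ n"
    if "h \<in> C" "dC g h < r" "N \<le> n" for h n
    using that eb[OF that(1,2)] dev[OF that(1)]
    by (intro est[OF _ _ AE_isom_dist_le[OF g that(1)]]) (auto simp: r_def)
  then show ?thesis
    using that[OF ess_bounded_nonneg[OF gR] r K q eb, of N] by blast
qed

text \<open>The time n is fixed first, the radius afterwards, since the Lipschitz constant grows
  with n. At positive drift \<open>local_estimates\<close> covers every neighbour in
  \<open>C\<close>, whatever is known about its drift.\<close>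

lemma drift_locally_continuous:
  assumes g: "g \<in> C" and e: "0 < e"
  shows "\<exists>r>0. \<forall>h\<in>C. dC g h < r \<longrightarrow> dist (drift M T x0 (rep g)) (drift M T x0 (rep h)) < e"
proof -
  interpret C: Metric_space C dC by (rule metric_C)
  obtain R0 where R0: "ess_bounded (rep g) R0" using rep_ess_bounded[OF g] .
  have d0: "0 \<le> drift M T x0 (rep h)" if "h \<in> C" for h
    using rep_ess_bounded[OF that] drift_nonneg by blast
  have small: "\<exists>s>0. \<forall>t. 0 \<le> t \<longrightarrow> t < s \<longrightarrow> c * t \<le> e / 2" if "0 < c" for c :: real
    using that e by (intro exI[of _ "e / 2 / c"]) (auto simp: field_simps)
  show ?thesis
  proof (cases "drift M T x0 (rep g) = 0")
    case True
    define R where "R = R0 + 1 / ln b"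
    have gR: "ess_bounded (rep g) R" using b by (intro ess_bounded_mono[OF R0]) (simp add: R_def)
    have "\<forall>\<^sub>F n in sequentially. mean_disp (rep g) n / real n < e / 2"
      using drift_limit[OF R0] True e by (intro order_tendstoD(2)[where a = "e/2"]) auto
    then obtain n where n: "1 \<le> n" "mean_disp (rep g) n / real n < e / 2"
      using eventually_happens'[OF sequentially_bot eventually_conj[OF eventually_ge_at_top[of 1]]] by blast
    have "0 < 2 / ln b * growth R ^ n"
      using growth_ge_2[OF ess_bounded_nonneg[OF gR]] b by (intro mult_pos_pos divide_pos_pos zero_less_power) auto
    from small[OF this] obtain s where s: "0 < s" "\<And>t. 0 \<le> t \<Longrightarrow> t < s \<Longrightarrow> 2 / ln b * growth R ^ n * t \<le> e / 2"
      by blast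
    show ?thesis
    proof (intro exI[of _ "min s (b powr - R0)"] conjI ballI impI)
      fix h assume h: "h \<in> C" "dC g h < min s (b powr - R0)"
      have hR: "ess_bounded (rep h) R"
        unfolding R_def using h by (intro nearby_ess_bounded[OF g h(1) R0]) auto
      have "real n * drift M T x0 (rep h) \<le> mean_disp (rep h) n"
        by (rule drift_le_mean_disp[OF hR])
      also have "\<dots> \<le> mean_disp (rep g) n + e / 2"
        using mean_disp_lipschitz[OF gR hR AE_isom_dist_le[OF g h(1)], of n] s(2)[of "dC g h"] h
        by (auto simp: abs_le_iff)
      also have "\<dots> < real n * (e / 2) + e / 2"
        using n by (simp add: field_simps)
      also have "\<dots> \<le> real n * (e / 2) + real n * (e / 2)"
        using n(1) e by (intro add_left_mono) simp
      also have "\<dots> = real n * e" by simp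
      finally have "drift M T x0 (rep h) < e" using n(1) by simp
      then show "dist (drift M T x0 (rep g)) (drift M T x0 (rep h)) < e"
        using True d0[OF h(1)] by (simp add: dist_real_def)
    qed (use s b in auto)
  next
    case False
    then have "g \<in> positive_drift M T x0 C" using g d0[OF g] by (simp add: positive_drift_def)
    from local_estimates[OF this] obtain R r K q N where R: "0 \<le> R" and r: "0 < r" and K: "0 \<le> K"
      and q: "0 < q" "q < 1"
      and eb: "\<And>h. h \<in> C \<Longrightarrow> dC g h < r \<Longrightarrow> ess_bounded (rep h) R"
      and est: "\<And>h n. h \<in> C \<Longrightarrow> dC g h < r \<Longrightarrow> N \<le> n \<Longrightarrow>
        \<bar>drift M T x0 (rep h) - (mean_disp (rep h) (Suc n) - mean_disp (rep h) n)\<bar> \<le> K * q ^ n"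
      by metis
    have "(\<lambda>n. 2 * K * q ^ n) \<longlonglongrightarrow> 2 * K * 0"
      using q by (intro tendsto_mult tendsto_const LIMSEQ_power_zero) auto
    then have "\<forall>\<^sub>F n in sequentially. 2 * K * q ^ n < e / 2"
      using e by (intro order_tendstoD) auto
    then obtain n where n: "N \<le> n" "2 * K * q ^ n < e / 2"
      using eventually_happens'[OF sequentially_bot eventually_conj[OF eventually_ge_at_top[of N]]] by blast
    have "0 < 2 / ln b * (growth R + 1) * growth R ^ n"
      using growth_ge_2[OF R] b by (intro mult_pos_pos divide_pos_pos zero_less_power) auto
    from small[OF this] obtain s where s: "0 < s"
      "\<And>t. 0 \<le> t \<Longrightarrow> t < s \<Longrightarrow> 2 / ln b * (growth R + 1) * growth R ^ n * t \<le> e / 2"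
      by blast
    show ?thesis
    proof (intro exI[of _ "min s r"] conjI ballI impI)
      fix h assume h: "h \<in> C" "dC g h < min s r"
      have gg: "dC g g < r" using g r by simp
      have "\<bar>drift M T x0 (rep g) - drift M T x0 (rep h)\<bar>
          \<le> 2 * K * q ^ n + 2 / ln b * (growth R + 1) * (growth R ^ n * dC g h)"
        using h by (intro drift_diff_le eb est g gg n(1) AE_isom_dist_le) auto
      also have "\<dots> < e"
        using n(2) s(2)[of "dC g h"] h by (simp add: mult.assoc)
      finally show "dist (drift M T x0 (rep g)) (drift M T x0 (rep h)) < e"
        by (simp add: dist_real_def)
    qed (use s r in auto)
  qed
qed

text \<open>Shared by the drift and the hitting point. The constant in \<open>bound\<close> may
  depend only on the local data \<open>R\<close>, \<open>q\<close>, \<open>K\<close> and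
  \<open>N\<close>, so it is uniform over a neighbourhood, and the free time \<open>n\<close> is
  what gets optimised.\<close>

lemma locally_hoelder_on_positive_drift:
  assumes bound: "\<And>R q K N. 0 \<le> R \<Longrightarrow> 0 < q \<Longrightarrow> q < 1 \<Longrightarrow> 0 \<le> K \<Longrightarrow> \<exists>K'\<ge>0. \<forall>g1 g2 t n.
      ess_bounded g1 R \<longrightarrow> ess_bounded g2 R \<longrightarrow> 0 \<le> t \<longrightarrow>
      (AE \<omega> in M. isom_dist x0 b (g1 \<omega>) (g2 \<omega>) \<le> t) \<longrightarrow> N \<le> n \<longrightarrow>
      (\<forall>g\<in>{g1, g2}. \<forall>n\<ge>N. exp_mean g n \<le> 2 * q ^ n \<and>
        \<bar>drift M T x0 g - (mean_disp g (Suc n) - mean_disp g n)\<bar> \<le> K * q ^ n) \<longrightarrow>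
      dB (f g1) (f g2) \<le> K' * (q ^ n + growth R ^ n * t)"
  shows "locally_hoelder (positive_drift M T x0 C) dC dB (\<lambda>g. f (rep g))"
proof (rule locally_hoelderI)
  interpret C: Metric_space C dC by (rule metric_C)
  show "Metric_space (positive_drift M T x0 C) dC"
    by (rule C.subspace) (auto simp: positive_drift_def)
  fix g assume gp: "g \<in> positive_drift M T x0 C"
  then have g: "g \<in> C" by (simp add: positive_drift_def)
  from local_estimates[OF gp] obtain R r K q N where R: "0 \<le> R" and r: "0 < r" and K: "0 \<le> K"
    and q: "0 < q" "q < 1"
    and eb: "\<And>h. h \<in> C \<Longrightarrow> dC g h < r \<Longrightarrow> ess_bounded (rep h) R"
    and em: "\<And>h n. h \<in> C \<Longrightarrow> dC g h < r \<Longrightarrow> N \<le> n \<Longrightarrow> exp_mean (rep h) n \<le> 2 * q ^ n"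
    and est: "\<And>h n. h \<in> C \<Longrightarrow> dC g h < r \<Longrightarrow> N \<le> n \<Longrightarrow>
      \<bar>drift M T x0 (rep h) - (mean_disp (rep h) (Suc n) - mean_disp (rep h) n)\<bar> \<le> K * q ^ n"
    by metis
  obtain K' where K': "0 \<le> K'" and main: "\<And>g1 g2 t n.
      ess_bounded g1 R \<Longrightarrow> ess_bounded g2 R \<Longrightarrow> 0 \<le> t \<Longrightarrow>
      AE \<omega> in M. isom_dist x0 b (g1 \<omega>) (g2 \<omega>) \<le> t \<Longrightarrow> N \<le> n \<Longrightarrow>
      (\<forall>g\<in>{g1, g2}. \<forall>n\<ge>N. exp_mean g n \<le> 2 * q ^ n \<and>
        \<bar>drift M T x0 g - (mean_disp g (Suc n) - mean_disp g n)\<bar> \<le> K * q ^ n) \<Longrightarrow>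
      dB (f g1) (f g2) \<le> K' * (q ^ n + growth R ^ n * t)"
    using bound[OF R q K, of N] by blast
  have "1 < growth R" using growth_ge_2[OF R] by simp
  from optimise_scale[OF q this K'] obtain \<alpha> K2 where \<alpha>: "0 < \<alpha>" and K2: "0 < K2"
    and opt: "\<And>t A. 0 \<le> t \<Longrightarrow> t \<le> 1 \<Longrightarrow> (\<And>n. N \<le> n \<Longrightarrow> A \<le> K' * (q ^ n + growth R ^ n * t)) \<Longrightarrow>
      A \<le> K2 * t powr \<alpha>"
    by metis
  \<comment> \<open>Radius 1 / 2 keeps the mutual distance at most 1, the range in which
    \<open>optimise_scale\<close> applies.\<close>
  have "\<forall>x\<in>positive_drift M T x0 C. \<forall>y\<in>positive_drift M T x0 C.
      dC g x < min r (1 / 2) \<longrightarrow> dC g y < min r (1 / 2) \<longrightarrow>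
      dB (f (rep x)) (f (rep y)) \<le> K2 * dC x y powr \<alpha>"
  proof (intro ballI impI)
    fix x y assume "x \<in> positive_drift M T x0 C" "y \<in> positive_drift M T x0 C"
      "dC g x < min r (1 / 2)" "dC g y < min r (1 / 2)"
    then have x: "x \<in> C" "dC g x < r" "dC g x < 1 / 2" and y: "y \<in> C" "dC g y < r" "dC g y < 1 / 2"
      by (auto simp: positive_drift_def)
    have "dC x y \<le> dC g x + dC g y"
      using C.triangle[OF x(1) g y(1)] C.commute[of x g] by simp
    then have "dC x y \<le> 1" using x y by simp
    then show "dB (f (rep x)) (f (rep y)) \<le> K2 * dC x y powr \<alpha>"
      using eb[OF x(1,2)] eb[OF y(1,2)] AE_isom_dist_le[OF x(1) y(1)] em[OF x(1,2)] em[OF y(1,2)]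
        est[OF x(1,2)] est[OF y(1,2)]
      by (intro opt main) auto
  qed
  moreover have "0 < min r (1 / 2)" using r by simp
  ultimately show "\<exists>r>0. \<exists>\<alpha>>0. \<exists>K>0. \<forall>x\<in>positive_drift M T x0 C. \<forall>y\<in>positive_drift M T x0 C.
      dC g x < r \<longrightarrow> dC g y < r \<longrightarrow> dB (f (rep x)) (f (rep y)) \<le> K * dC x y powr \<alpha>"
    using \<alpha> K2 by blast
qed

lemma drift_locally_hoelder:
  "locally_hoelder (positive_drift M T x0 C) dC dist (\<lambda>g. drift M T x0 (rep g))"
proof (rule locally_hoelder_on_positive_drift[where f = "drift M T x0"])
  fix R q K :: real and N :: nat assume R: "0 \<le> R" and q: "0 < q" "q < 1" and K: "0 \<le> K"
  define v where "v = 2 / ln b * (growth R + 1)"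
  have v: "0 \<le> v" using growth_ge_2[OF R] b by (simp add: v_def)
  have "dist (drift M T x0 g1) (drift M T x0 g2) \<le> (2 * K + v) * (q ^ n + growth R ^ n * t)"
    if h: "ess_bounded g1 R" "ess_bounded g2 R" "0 \<le> t" "AE \<omega> in M. isom_dist x0 b (g1 \<omega>) (g2 \<omega>) \<le> t" "N \<le> n"
      "\<forall>g\<in>{g1, g2}. \<forall>n\<ge>N. exp_mean g n \<le> 2 * q ^ n \<and>
        \<bar>drift M T x0 g - (mean_disp g (Suc n) - mean_disp g n)\<bar> \<le> K * q ^ n" for g1 g2 t n
  proof -
    have "\<bar>drift M T x0 g1 - drift M T x0 g2\<bar> \<le> 2 * K * q ^ n + v * (growth R ^ n * t)"
      unfolding v_def using h by (intro drift_diff_le) auto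
    also have "\<dots> \<le> (2 * K + v) * (q ^ n + growth R ^ n * t)"
      using K v q h(3) growth_ge_2[OF R] by (intro two_term_le) auto
    finally show ?thesis by (simp add: dist_real_def)
  qed
  then show "\<exists>K'\<ge>0. \<forall>g1 g2 t n. ess_bounded g1 R \<longrightarrow> ess_bounded g2 R \<longrightarrow> 0 \<le> t \<longrightarrow>
      (AE \<omega> in M. isom_dist x0 b (g1 \<omega>) (g2 \<omega>) \<le> t) \<longrightarrow> N \<le> n \<longrightarrow>
      (\<forall>g\<in>{g1, g2}. \<forall>n\<ge>N. exp_mean g n \<le> 2 * q ^ n \<and>
        \<bar>drift M T x0 g - (mean_disp g (Suc n) - mean_disp g n)\<bar> \<le> K * q ^ n) \<longrightarrow>
      dist (drift M T x0 g1) (drift M T x0 g2) \<le> K' * (q ^ n + growth R ^ n * t)"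
    using K v by (intro exI[of _ "2 * K + v"] conjI) auto
qed

lemma hitting_point_locally_hoelder:
  "locally_hoelder (positive_drift M T x0 C) dC (dist_one M x0 b) (\<lambda>g. hitting_point T x0 (rep g))"
proof (rule locally_hoelder_on_positive_drift[where f = "hitting_point T x0"])
  fix R q K :: real and N :: nat assume R: "0 \<le> R" and q: "0 < q" "q < 1" and K: "0 \<le> K"
  define u where "u = 2 * b powr R * (2 / (1 - q)) + 2 * b"
  define v where "v = 2 / ln b"
  have uv: "0 \<le> u" "0 \<le> v" using q b by (simp_all add: u_def v_def)
  have "dist_one M x0 b (hitting_point T x0 g1) (hitting_point T x0 g2) \<le> (u + v) * (q ^ n + growth R ^ n * t)"
    if h: "ess_bounded g1 R" "ess_bounded g2 R" "0 \<le> t" "AE \<omega> in M. isom_dist x0 b (g1 \<omega>) (g2 \<omega>) \<le> t" "N \<le> n"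
      "\<forall>g\<in>{g1, g2}. \<forall>n\<ge>N. exp_mean g n \<le> 2 * q ^ n \<and>
        \<bar>drift M T x0 g - (mean_disp g (Suc n) - mean_disp g n)\<bar> \<le> K * q ^ n" for g1 g2 t n
  proof -
    have "dist_one M x0 b (hitting_point T x0 g1) (hitting_point T x0 g2) \<le> u * q ^ n + v * (growth R ^ n * t)"
      unfolding u_def v_def using h q by (intro dist_one_hitting_point_le[where N = N]) auto
    also have "\<dots> \<le> (u + v) * (q ^ n + growth R ^ n * t)"
      using uv q h(3) growth_ge_2[OF R] by (intro two_term_le) auto
    finally show ?thesis .
  qed
  then show "\<exists>K'\<ge>0. \<forall>g1 g2 t n. ess_bounded g1 R \<longrightarrow> ess_bounded g2 R \<longrightarrow> 0 \<le> t \<longrightarrow>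
      (AE \<omega> in M. isom_dist x0 b (g1 \<omega>) (g2 \<omega>) \<le> t) \<longrightarrow> N \<le> n \<longrightarrow>
      (\<forall>g\<in>{g1, g2}. \<forall>n\<ge>N. exp_mean g n \<le> 2 * q ^ n \<and>
        \<bar>drift M T x0 g - (mean_disp g (Suc n) - mean_disp g n)\<bar> \<le> K * q ^ n) \<longrightarrow>
      dist_one M x0 b (hitting_point T x0 g1) (hitting_point T x0 g2) \<le> K' * (q ^ n + growth R ^ n * t)"
    using uv by (intro exI[of _ "u + v"] conjI) auto
qed

lemma hitting_point_S_one:
  assumes "g \<in> positive_drift M T x0 C"
  shows "hitting_point T x0 (rep g) \<in> S_one M x0 b"
proof -
  interpret C: Metric_space C dC by (rule metric_C)
  have g: "g \<in> C" using assms by (simp add: positive_drift_def)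
  from local_estimates[OF assms] obtain R r q N where r: "0 < r" and q: "0 < q" "q < 1"
    and eb: "\<And>h. h \<in> C \<Longrightarrow> dC g h < r \<Longrightarrow> ess_bounded (rep h) R"
    and em: "\<And>h n. h \<in> C \<Longrightarrow> dC g h < r \<Longrightarrow> N \<le> n \<Longrightarrow> exp_mean (rep h) n \<le> 2 * q ^ n"
    by metis
  have gg: "dC g g < r" using g r by simp
  have "AE \<omega> in M. gromov_seq x0 (\<lambda>n. cocycle T (rep g) n \<omega> x0)"
    using AE_hitting_point[OF eb[OF g gg] q em[OF g gg]] by auto
  then show ?thesis by (rule hitting_point_measurable[OF ess_boundedD[OF eb[OF g gg]]])
qed

lemma drift_continuous_map:
  "continuous_map (Metric_space.mtopology C dC) euclideanreal (\<lambda>g. drift M T x0 (rep g))"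
proof -
  interpret C: Metric_space C dC by (rule metric_C)
  have "continuous_map C.mtopology (Metric_space.mtopology UNIV dist) (\<lambda>g. drift M T x0 (rep g))"
    unfolding C.metric_continuous_map[OF Met_TC.Metric_space_axioms]
    using drift_locally_continuous by (intro conjI ballI allI impI) (simp, blast)
  then show ?thesis by simp
qed

end

theorem theorem2:
  fixes M :: "'w measure" and T :: "'w \<Rightarrow> 'w"
    and x0 :: "'x::metric_space" and \<delta> b :: real
    and C :: "('w \<Rightarrow> 'x \<Rightarrow> 'x) set set"
    and dC :: "('w \<Rightarrow> 'x \<Rightarrow> 'x) set \<Rightarrow> ('w \<Rightarrow> 'x \<Rightarrow> 'x) set \<Rightarrow> real"
  assumes "gromov_hyperbolic (UNIV :: 'x set) \<delta>"
    and "1 < b" and "b \<le> 2 powr (1 / \<delta>)"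
    and "strongly_hyperbolic x0 b"
    and "geodesic_space (UNIV :: 'x set)"
    and "separable_space (euclidean :: 'x topology)"
    and "standard_prob_space M"
    and "ergodic_mpt M T"
    and "C \<subseteq> S_infty M x0 b"
    and "Metric_space C dC"
    and "\<And>g1 g2. g1 \<in> C \<Longrightarrow> g2 \<in> C \<Longrightarrow>
           ereal (dC g1 g2) \<ge> dist_infty M x0 b (rep g1) (rep g2)"
    and "\<And>g. g \<in> positive_drift M T x0 C \<Longrightarrow> uniform_LDE M T x0 b C dC g"
  shows "continuous_map (Metric_space.mtopology C dC) euclideanreal (\<lambda>g. drift M T x0 (rep g)) \<and>
         locally_hoelder (positive_drift M T x0 C) dC dist (\<lambda>g. drift M T x0 (rep g)) \<and>
         (\<forall>g \<in> positive_drift M T x0 C. hitting_point T x0 (rep g) \<in> S_one M x0 b) \<and>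
         locally_hoelder (positive_drift M T x0 C) dC (dist_one M x0 b)
           (\<lambda>g. hitting_point T x0 (rep g))"
proof -
  have "prob_space M" using assms(7) by (simp add: standard_prob_space_def)
  moreover have "T \<in> M \<rightarrow>\<^sub>M M" "distr M M T = M" using assms(8) by (simp_all add: ergodic_mpt_def)
  ultimately interpret cocycle_class x0 b M T C dC
    using assms by (intro cocycle_class.intro cocycle_system.intro strongly_hyperbolic_space.intro
      cocycle_system_axioms.intro cocycle_class_axioms.intro)
  show ?thesis
    by (intro conjI ballI drift_continuous_map drift_locally_hoelder hitting_point_S_one
      hitting_point_locally_hoelder)
qed

end
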